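(* (i) For any closed subset $\mathscr{F}$ of $[0,1]$, $$\limsup_{N\to\infty}\frac1N\log\mu^N_{ss}\big[\widehat m(\pi^N)\in\mathscr{F}\big]\le-\inf_{m\in\mathscr{F}}V(m).$$ (ii) For any open subset $\mathscr{O}$ of $[0,1]$, $$\liminf_{N\to\infty}\frac1N\log\mu^N_{ss}\big[\widehat m(\pi^N)\in\mathscr{O}\big]\ge-\inf_{m\in\mathscr{O}}V(m).$$
   Context: Fix $0<\alpha,\beta<1$ and set $\gamma=(\alpha+\beta)/2$. For $N\ge 3$ let $\Sigma_N=\{1,\dots,N-1\}$, $\Omega_N=\{0,1\}^{\Sigma_N}$, $r_1=\alpha$, $r_{N-1}=\beta$. For $f:\Omega_N\to\mathbb{R}$ define $(\mathcal{L}_{N,0}f)(\eta)=\sum_{x=1}^{N-2}(f(\eta^{x,x+1})-f(\eta))$ and $(\mathcal{L}_{N,b}f)(\eta)=\sum_{x\in\{1,N-1\}}[r_x(1-\eta(x))+(1-r_x)\eta(x)](f(\eta^x)-f(\eta))$, where $\eta^{x,x+1}$ is obtained from $\eta$ by exchanging the values at $x$ and $x+1$, and $\eta^x$ by replacing $\eta(x)$ with $1-\eta(x)$. $\mu^N_{ss}$ is the unique stationary probability measure on $\Omega_N$ of the (irreducible) Markov process with generator $N^2\mathcal{L}_{N,0}+\mathcal{L}_{N,b}$. The empirical measure is $\pi^N=\pi^N(\eta)=\frac1N\sum_{x=1}^{N-1}\eta(x)\delta_{x/N}$ and its total mass is $\widehat m(\pi^N)=\frac1N\sum_{x=1}^{N-1}\eta(x)$.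 For $T>0$ let $\mathcal{D}^T_{[0,1]}$ be the set of right-continuous functions with left limits $a:[0,T]\to[0,1]$. For real-valued $G\in C^1([0,T])$ and $a\in\mathcal{D}^T_{[0,1]}$ set $$J_{T,G}(a)=a_TG_T-a_0G_0-\int_0^Ta_s\,\partial_sG_s\,ds-\int_0^T\big[2\gamma(1-a_s)(e^{G_s}-1)+2(1-\gamma)a_s(e^{-G_s}-1)\big]ds.$$ Let $I_T(a)=\sup_{G\in C^1([0,T])}J_{T,G}(a)$, and let $I_T(a|\gamma)=I_T(a)$ if $a(0)=\gamma$, $+\infty$ otherwise. The quasi-potential is $V(m)=\inf_{T>0}\inf_a I_T(a|\gamma)$, $m\in[0,1]$, the second infimum being over $[0,1]$-valued $a\in C^1([0,T])$ with $a(T)=m$. *)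

theory Defs
  imports "HOL-Probability.Probability"
begin

section \<open>Exclusion process with weakly coupled boundary reservoirs\<close>

text \<open>A configuration is an extensional function on the sites
  \<open>{1..N-1}\<close> with values 0 and 1; only \<open>N \<ge> 3\<close> is relevant.\<close>

definition configs :: "nat \<Rightarrow> (nat \<Rightarrow> nat) set" where
  "configs N = {1..N-1} \<rightarrow>\<^sub>E {0, 1}"

definition exchange :: "nat \<Rightarrow> nat \<Rightarrow> (nat \<Rightarrow> nat) \<Rightarrow> nat \<Rightarrow> nat" where
  "exchange x y \<eta> = \<eta>(x := \<eta> y, y := \<eta> x)"

definition flip :: "nat \<Rightarrow> (nat \<Rightarrow> nat) \<Rightarrow> nat \<Rightarrow> nat" where
  "flip x \<eta> = \<eta>(x := 1 - \<eta> x)"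

definition gen_bulk :: "nat \<Rightarrow> ((nat \<Rightarrow> nat) \<Rightarrow> real) \<Rightarrow> (nat \<Rightarrow> nat) \<Rightarrow> real" where
  "gen_bulk N f \<eta> = (\<Sum>x = 1..N-2. f (exchange x (x + 1) \<eta>) - f \<eta>)"

definition reservoir :: "real \<Rightarrow> real \<Rightarrow> nat \<Rightarrow> real" where
  "reservoir \<alpha> \<beta> x = (if x = 1 then \<alpha> else \<beta>)"

definition gen_boundary ::
    "real \<Rightarrow> real \<Rightarrow> nat \<Rightarrow> ((nat \<Rightarrow> nat) \<Rightarrow> real) \<Rightarrow> (nat \<Rightarrow> nat) \<Rightarrow> real" where
  "gen_boundary \<alpha> \<beta> N f \<eta> =
     (\<Sum>x\<in>{1, N-1}.
        (reservoir \<alpha> \<beta> x * (1 - real (\<eta> x)) + (1 - reservoir \<alpha> \<beta> x) * real (\<eta> x))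
        * (f (flip x \<eta>) - f \<eta>))"

definition gen ::
    "real \<Rightarrow> real \<Rightarrow> nat \<Rightarrow> ((nat \<Rightarrow> nat) \<Rightarrow> real) \<Rightarrow> (nat \<Rightarrow> nat) \<Rightarrow> real" where
  "gen \<alpha> \<beta> N f \<eta> = (real N)\<^sup>2 * gen_bulk N f \<eta> + gen_boundary \<alpha> \<beta> N f \<eta>"

text \<open>The Markov semigroup \<open>exp (t L)\<close>. On \<^term>\<open>configs N\<close> the series converges,
  since the state space is finite and \<open>L\<close> is therefore bounded.\<close>

definition semigroup_op ::
    "real \<Rightarrow> real \<Rightarrow> nat \<Rightarrow> real \<Rightarrow> ((nat \<Rightarrow> nat) \<Rightarrow> real) \<Rightarrow> (nat \<Rightarrow> nat) \<Rightarrow> real" where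
  "semigroup_op \<alpha> \<beta> N t f \<eta> = (\<Sum>n. t ^ n / fact n * ((gen \<alpha> \<beta> N ^^ n) f \<eta>))"

definition stationary :: "real \<Rightarrow> real \<Rightarrow> nat \<Rightarrow> (nat \<Rightarrow> nat) pmf \<Rightarrow> bool" where
  "stationary \<alpha> \<beta> N \<mu> \<longleftrightarrow>
     set_pmf \<mu> \<subseteq> configs N \<and>
     (\<forall>t\<ge>0. \<forall>f. measure_pmf.expectation \<mu> (semigroup_op \<alpha> \<beta> N t f) =
                 measure_pmf.expectation \<mu> f)"

text \<open>The total mass of the empirical measure \<open>(1/N) \<Sum>\<^sub>x \<eta>(x) \<delta>\<^bsub>x/N\<^esub>\<close>.\<close>

definition total_mass :: "nat \<Rightarrow> (nat \<Rightarrow> nat) \<Rightarrow> real" where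
  "total_mass N \<eta> = (1 / real N) * (\<Sum>x = 1..N-1. real (\<eta> x))"

section \<open>Rate functional and quasi-potential\<close>

text \<open>Continuously differentiable functions on \<open>[0,T]\<close>, with one-sided derivatives at the
  end points. Values outside \<open>[0,T]\<close> are irrelevant.\<close>

definition C1 :: "real \<Rightarrow> (real \<Rightarrow> real) set" where
  "C1 T = {g. \<exists>g'. continuous_on {0..T} g' \<and>
                   (\<forall>t\<in>{0..T}. (g has_real_derivative g' t) (at t within {0..T}))}"

definition J :: "real \<Rightarrow> real \<Rightarrow> (real \<Rightarrow> real) \<Rightarrow> (real \<Rightarrow> real) \<Rightarrow> real" where
  "J \<gamma> T G a =
     a T * G T - a 0 * G 0
     - integral {0..T} (\<lambda>s. a s * vector_derivative G (at s within {0..T}))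
     - integral {0..T} (\<lambda>s. 2 * \<gamma> * (1 - a s) * (exp (G s) - 1)
                           + 2 * (1 - \<gamma>) * a s * (exp (- G s) - 1))"

definition rate :: "real \<Rightarrow> real \<Rightarrow> (real \<Rightarrow> real) \<Rightarrow> ereal" where
  "rate \<gamma> T a = (SUP G\<in>C1 T. ereal (J \<gamma> T G a))"

definition rate_from :: "real \<Rightarrow> real \<Rightarrow> (real \<Rightarrow> real) \<Rightarrow> ereal" where
  "rate_from \<gamma> T a = (if a 0 = \<gamma> then rate \<gamma> T a else \<infinity>)"

definition quasi_potential :: "real \<Rightarrow> real \<Rightarrow> ereal" where
  "quasi_potential \<gamma> m =
     (INF T\<in>{0<..}. INF a\<in>{a \<in> C1 T. (\<forall>s\<in>{0..T}. a s \<in> {0..1}) \<and> a T = m}.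
        rate_from \<gamma> T a)"

text \<open>Extended logarithm of a probability: in HOL \<^term>\<open>ln (0::real)\<close> is \<open>0\<close>, whereas
  here \<open>log 0 = -\<infinity>\<close> is meant.\<close>

definition elog :: "real \<Rightarrow> ereal" where
  "elog p = (if p = 0 then - \<infinity> else ereal (ln p))"

end

theory Submission
  imports Defs "HOL-Real_Asymp.Real_Asymp"
begin

text \<open>The quasi-potential is the relative entropy
  \<open>W(m) = m log (m/\<gamma>) + (1-m) log ((1-m)/(1-\<gamma>))\<close>: its derivative annihilates the Hamiltonian
  of the rate functional, so testing with \<open>G = W'(a)\<close> gives \<open>V \<ge> W\<close>, and following the
  time-reversed relaxation path gives \<open>V \<le> W\<close>.

  For the stationary measure, the correlations of \<open>\<eta> - \<beta>\<close> solve a closed system, dual to an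
  exclusion process absorbed at the boundary. The maximum principle gives uniqueness, and the
  explicit solution for a set of \<open>n\<close> sites is \<open>((\<alpha>-\<beta>)/2)\<^sup>n\<close> up to a factor between
  \<open>(1-1/N)\<^sup>n\<close> and \<open>(1+1/N)\<^sup>n\<close>, because the bulk equilibrates before a particle
  leaves. Expanding \<open>exp (\<theta> \<eta>)\<close> around the reservoir density for which all terms are nonnegative,
  the moment generating function of the mass agrees with that of a Bernoulli(\<open>\<gamma>\<close>) product up to
  a bounded factor, and the Gaertner-Ellis argument applies.\<close>

section \<open>The quasi-potential\<close>

text \<open>For \<alpha> \<noteq> \<beta> the stationary measure is not a product, and the expansion
  of the moment generating function has 2^(N-1) terms. A relative error (1 - 1/N)^n or (1 + 1/N)^n
  in the correlation of n sites resums to a factor (1 - 1/N)^(N-1) or (1 + 1/N)^(N-1), harmless on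
  the exponential scale, but only if the terms do not cancel. Hence the centre depends on the sign
  of \<theta>(\<alpha> - \<beta>). Centring at a reservoir density makes one absorption value zero,
  so that only the event that all dual particles leave at the other end contributes.

  The constants in \<open>dual_factor\<close> and \<open>dual_solution\<close> come from a single
  dual particle. An exit at rate 1, against bulk jumps at rate N^2, acts as a bond of length N^2.
  The right reservoir is then at distance N^2 + N - 1 - x from x, and the two reservoirs are at
  distance N^2 + (N - 2) + N^2 from each other; the quotient is the probability of leaving on the
  left.\<close>

definition bernoulli_entropy :: "real \<Rightarrow> real \<Rightarrow> real" where
  "bernoulli_entropy \<gamma> m = m * ln (m / \<gamma>) + (1 - m) * ln ((1 - m) / (1 - \<gamma>))"

text \<open>Cumulant function, per unit time, of unit jumps up at rate 2\<gamma>(1-a) and down at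
  rate 2(1-\<gamma>)a; it is the last integrand of \<open>J\<close>.\<close>

definition hamiltonian :: "real \<Rightarrow> real \<Rightarrow> real \<Rightarrow> real" where
  "hamiltonian \<gamma> a p = 2 * \<gamma> * (1 - a) * (exp p - 1) + 2 * (1 - \<gamma>) * a * (exp (- p) - 1)"

text \<open>Regularised derivative of \<open>bernoulli_entropy\<close>, bounded on [0,1]. The shifts
  are proportional to \<gamma> and 1-\<gamma>, so the value at m = \<gamma> stays 0 and the shifted
  masses add up to 1 + \<epsilon>.\<close>

definition tilt :: "real \<Rightarrow> real \<Rightarrow> real \<Rightarrow> real" where
  "tilt \<gamma> \<epsilon> m = ln ((m + \<epsilon> * \<gamma>) / \<gamma>) - ln ((1 - m + \<epsilon> * (1 - \<gamma>)) / (1 - \<gamma>))"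

lemma xlnx_perturb:
  fixes x y \<epsilon> :: real
  assumes "x \<ge> 0" "y > 0" "\<epsilon> > 0"
  shows "x * ln (x / y) \<le> x * ln ((x + \<epsilon> * y) / y)"
proof (cases "x = 0")
  case False
  then have "ln (x / y) \<le> ln ((x + \<epsilon> * y) / y)"
    using assms by (intro ln_mono divide_right_mono) auto
  then show ?thesis using assms by (intro mult_left_mono) auto
qed simp

lemma exp_tilt:
  assumes "0 < \<gamma>" "\<gamma> < 1" "\<epsilon> > 0" "0 \<le> m" "m \<le> 1"
  shows "exp (tilt \<gamma> \<epsilon> m) = ((m + \<epsilon> * \<gamma>) / \<gamma>) / ((1 - m + \<epsilon> * (1 - \<gamma>)) / (1 - \<gamma>))"
    and "exp (- tilt \<gamma> \<epsilon> m) = ((1 - m + \<epsilon> * (1 - \<gamma>)) / (1 - \<gamma>)) / ((m + \<epsilon> * \<gamma>) / \<gamma>)"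
proof -
  have "(m + \<epsilon> * \<gamma>) / \<gamma> > 0" "(1 - m + \<epsilon> * (1 - \<gamma>)) / (1 - \<gamma>) > 0"
    using assms by (auto intro!: divide_pos_pos add_nonneg_pos)
  then show "exp (tilt \<gamma> \<epsilon> m) = ((m + \<epsilon> * \<gamma>) / \<gamma>) / ((1 - m + \<epsilon> * (1 - \<gamma>)) / (1 - \<gamma>))"
    "exp (- tilt \<gamma> \<epsilon> m) = ((1 - m + \<epsilon> * (1 - \<gamma>)) / (1 - \<gamma>)) / ((m + \<epsilon> * \<gamma>) / \<gamma>)"
    unfolding tilt_def by (simp_all add: exp_diff)
qed

text \<open>For \<epsilon> = 0 the tilt interchanges the up and down rates and the Hamiltonian is 0.
  The shifts produce ratios (1-a)/v and a/u of at most 1; what remains is the excess of u over a and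
  of v over 1-a.\<close>

lemma hamiltonian_tilt_le:
  assumes "0 < \<gamma>" "\<gamma> < 1" "\<epsilon> > 0" "0 \<le> a" "a \<le> 1"
  shows "hamiltonian \<gamma> a (tilt \<gamma> \<epsilon> a) \<le> 4 * \<epsilon> * \<gamma> * (1 - \<gamma>)"
proof -
  define u where "u = a + \<epsilon> * \<gamma>"
  define v where "v = 1 - a + \<epsilon> * (1 - \<gamma>)"
  have uv: "u > 0" "v > 0" "a \<le> u" "1 - a \<le> v"
    unfolding u_def v_def using assms by (auto intro!: add_nonneg_pos)
  have "\<gamma> * (1 - a) * exp (tilt \<gamma> \<epsilon> a) = (1 - \<gamma>) * u * ((1 - a) / v)"
    unfolding exp_tilt(1)[OF assms] u_def[symmetric] v_def[symmetric] using assms uv by (simp add: field_simps)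
  also have "\<dots> \<le> (1 - \<gamma>) * u * 1"
    using assms uv by (intro mult_left_mono) auto
  finally have 1: "\<gamma> * (1 - a) * exp (tilt \<gamma> \<epsilon> a) \<le> (1 - \<gamma>) * u" by simp
  have "(1 - \<gamma>) * a * exp (- tilt \<gamma> \<epsilon> a) = \<gamma> * v * (a / u)"
    unfolding exp_tilt(2)[OF assms] u_def[symmetric] v_def[symmetric] using assms uv by (simp add: field_simps)
  also have "\<dots> \<le> \<gamma> * v * 1"
    using assms uv by (intro mult_left_mono) auto
  finally have 2: "(1 - \<gamma>) * a * exp (- tilt \<gamma> \<epsilon> a) \<le> \<gamma> * v" by simp
  have "hamiltonian \<gamma> a (tilt \<gamma> \<epsilon> a)
      = 2 * (\<gamma> * (1 - a) * exp (tilt \<gamma> \<epsilon> a)) + 2 * ((1 - \<gamma>) * a * exp (- tilt \<gamma> \<epsilon> a)) - 2 * \<gamma> * (1 - a) - 2 * (1 - \<gamma>) * a"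
    unfolding hamiltonian_def by (simp add: algebra_simps)
  also have "\<dots> \<le> 2 * ((1 - \<gamma>) * u) + 2 * (\<gamma> * v) - 2 * \<gamma> * (1 - a) - 2 * (1 - \<gamma>) * a"
    using 1 2 by linarith
  also have "\<dots> = 4 * \<epsilon> * \<gamma> * (1 - \<gamma>)" unfolding u_def v_def by (simp add: algebra_simps)
  finally show ?thesis .
qed

text \<open>Integration by parts moves the derivative from G to the path and turns \<open>J\<close>
  into an action. Both bounds on the quasi-potential then compare integrands pointwise.\<close>

lemma J_has_integral:
  assumes T: "T > 0" and a': "continuous_on {0..T} a'"
    "\<And>t. t \<in> {0..T} \<Longrightarrow> (a has_real_derivative a' t) (at t within {0..T})"
    and G: "G \<in> C1 T"
  shows "((\<lambda>s. a' s * G s - hamiltonian \<gamma> (a s) (G s)) has_integral J \<gamma> T G a) {0..T}"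
proof -
  obtain G' where G': "continuous_on {0..T} G'"
    "\<And>t. t \<in> {0..T} \<Longrightarrow> (G has_real_derivative G' t) (at t within {0..T})"
    using G unfolding C1_def by blast
  have ca: "continuous_on {0..T} a" using a'(2) DERIV_continuous_on by blast
  have cG: "continuous_on {0..T} G" using G'(2) DERIV_continuous_on by blast
  have vd: "vector_derivative G (at s within {0..T}) = G' s" if "s \<in> {0..T}" for s
    using G'(2)[OF that] T that
    by (intro vector_derivative_within_closed_interval) (auto simp: has_real_derivative_iff_has_vector_derivative)
  have 1: "((\<lambda>s. a' s * G s + a s * G' s) has_integral (a T * G T - a 0 * G 0)) {0..T}"
    using T a'(2) G'(2)
    by (intro fundamental_theorem_of_calculus)
       (auto simp flip: has_real_derivative_iff_has_vector_derivative intro!: derivative_eq_intros)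
  have "(\<lambda>s. a s * G' s) integrable_on {0..T}"
    using ca G'(1) by (intro integrable_continuous_real continuous_intros)
  then have 2: "((\<lambda>s. a s * G' s) has_integral integral {0..T} (\<lambda>s. a s * vector_derivative G (at s within {0..T}))) {0..T}"
    using vd by (subst Henstock_Kurzweil_Integration.integral_cong[where g = "\<lambda>s. a s * G' s"])
      (auto simp: integrable_integral)
  have "(\<lambda>s. hamiltonian \<gamma> (a s) (G s)) integrable_on {0..T}"
    unfolding hamiltonian_def using ca cG by (intro integrable_continuous_real continuous_intros)
  then have 3: "((\<lambda>s. hamiltonian \<gamma> (a s) (G s)) has_integral integral {0..T} (\<lambda>s. hamiltonian \<gamma> (a s) (G s))) {0..T}"
    by (rule integrable_integral)
  have "((\<lambda>s. a' s * G s + a s * G' s - a s * G' s - hamiltonian \<gamma> (a s) (G s)) has_integral J \<gamma> T G a) {0..T}"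
    unfolding J_def using has_integral_diff[OF has_integral_diff[OF 1 2] 3]
    by (simp add: hamiltonian_def)
  then show ?thesis by simp
qed

text \<open>The smoothing \<open>\<epsilon>\<close> keeps the test function \<open>C\<^sup>1\<close> where the path touches 0 or 1.\<close>

lemma entropy_le_rate:
  assumes \<gamma>: "0 < \<gamma>" "\<gamma> < 1" and T: "T > 0" and a: "a \<in> C1 T"
    and range: "\<And>s. s \<in> {0..T} \<Longrightarrow> a s \<in> {0..1}" and a0: "a 0 = \<gamma>"
  shows "ereal (bernoulli_entropy \<gamma> (a T)) \<le> rate \<gamma> T a"
proof -
  obtain a' where a': "continuous_on {0..T} a'"
    "\<And>t. t \<in> {0..T} \<Longrightarrow> (a has_real_derivative a' t) (at t within {0..T})"
    using a unfolding C1_def by blast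
  have ca: "continuous_on {0..T} a" using a'(2) DERIV_continuous_on by blast
  let ?m = "a T"
  have m: "?m \<in> {0..1}" using range T by auto
  \<comment> \<open>\<epsilon> ln \<epsilon> is lost at the end of the path, (1+\<epsilon>) ln
    (1+\<epsilon>) is the smoothed entropy at its start, and the last term is the Hamiltonian error
    accumulated over time T.\<close>
  let ?r = "\<lambda>\<epsilon>. bernoulli_entropy \<gamma> ?m + \<epsilon> * ln \<epsilon> - (1 + \<epsilon>) * ln (1 + \<epsilon>) - 4 * \<epsilon> * \<gamma> * (1 - \<gamma>) * T"
  have le: "ereal (?r \<epsilon>) \<le> rate \<gamma> T a" if \<epsilon>: "\<epsilon> > 0" for \<epsilon>
  proof -
    define G where "G s = tilt \<gamma> \<epsilon> (a s)" for s
    \<comment> \<open>A primitive of \<open>tilt\<close>: the constants +1 and -1 from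
      differentiating the two products cancel.\<close>
    define F where "F x = (x + \<epsilon> * \<gamma>) * ln ((x + \<epsilon> * \<gamma>) / \<gamma>)
       + (1 - x + \<epsilon> * (1 - \<gamma>)) * ln ((1 - x + \<epsilon> * (1 - \<gamma>)) / (1 - \<gamma>))" for x
    have pos: "x + \<epsilon> * \<gamma> > 0" "1 - x + \<epsilon> * (1 - \<gamma>) > 0" if "x \<in> {0..1}" for x
      using that \<gamma> \<epsilon> by (auto intro!: add_nonneg_pos)
    have dF: "(F has_real_derivative tilt \<gamma> \<epsilon> x) (at x)" if "x \<in> {0..1}" for x
      unfolding F_def tilt_def using pos[OF that] \<gamma>
      by (auto intro!: derivative_eq_intros simp: divide_simps) (simp add: algebra_simps)
    have dG: "(G has_real_derivative (1 / (a s + \<epsilon> * \<gamma>) + 1 / (1 - a s + \<epsilon> * (1 - \<gamma>))) * a' s) (at s within {0..T})"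
      if "s \<in> {0..T}" for s
    proof -
      have "(tilt \<gamma> \<epsilon> has_real_derivative 1 / (a s + \<epsilon> * \<gamma>) + 1 / (1 - a s + \<epsilon> * (1 - \<gamma>))) (at (a s))"
        unfolding tilt_def using pos[OF range[OF that]] \<gamma>
        by (auto intro!: derivative_eq_intros simp: divide_simps) (simp add: algebra_simps)
      from DERIV_chain2[OF this a'(2)[OF that]] show ?thesis unfolding G_def .
    qed
    have "G \<in> C1 T"
      unfolding C1_def
    proof (intro CollectI exI conjI ballI)
      have nz: "\<forall>s\<in>{0..T}. a s + \<epsilon> * \<gamma> \<noteq> 0" "\<forall>s\<in>{0..T}. 1 - a s + \<epsilon> * (1 - \<gamma>) \<noteq> 0"
        using pos[OF range] by (metis less_irrefl)+
      show "continuous_on {0..T} (\<lambda>s. (1 / (a s + \<epsilon> * \<gamma>) + 1 / (1 - a s + \<epsilon> * (1 - \<gamma>))) * a' s)"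
        by (intro continuous_intros ca a'(1) nz)
    qed (rule dG)
    then have "ereal (J \<gamma> T G a) \<le> rate \<gamma> T a" unfolding rate_def by (rule SUP_upper)
    have I1: "((\<lambda>s. a' s * G s - hamiltonian \<gamma> (a s) (G s)) has_integral J \<gamma> T G a) {0..T}"
      by (rule J_has_integral[OF T a' \<open>G \<in> C1 T\<close>])
    have "((\<lambda>s. tilt \<gamma> \<epsilon> (a s) * a' s) has_integral (F (a T) - F (a 0))) {0..T}"
    proof (intro fundamental_theorem_of_calculus)
      fix s assume s: "s \<in> {0..T}"
      from DERIV_chain2[OF dF[OF range[OF s]] a'(2)[OF s]]
      show "((\<lambda>s. F (a s)) has_vector_derivative tilt \<gamma> \<epsilon> (a s) * a' s) (at s within {0..T})"
        by (simp add: has_real_derivative_iff_has_vector_derivative)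
    qed (use T in simp)
    moreover have "((\<lambda>s. 4 * \<epsilon> * \<gamma> * (1 - \<gamma>)) has_integral T * (4 * \<epsilon> * \<gamma> * (1 - \<gamma>))) {0..T}"
      using has_integral_const_real[of "4 * \<epsilon> * \<gamma> * (1 - \<gamma>)" 0 T] T by simp
    ultimately have I2: "((\<lambda>s. tilt \<gamma> \<epsilon> (a s) * a' s - 4 * \<epsilon> * \<gamma> * (1 - \<gamma>)) has_integral
        (F (a T) - F (a 0) - T * (4 * \<epsilon> * \<gamma> * (1 - \<gamma>)))) {0..T}"
      by (rule has_integral_diff)
    have J: "F (a T) - F (a 0) - T * (4 * \<epsilon> * \<gamma> * (1 - \<gamma>)) \<le> J \<gamma> T G a"
    proof (rule has_integral_le[OF I2 I1])
      fix s assume "s \<in> {0..T}"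
      then have "a s \<in> {0..1}" by (rule range)
      then show "tilt \<gamma> \<epsilon> (a s) * a' s - 4 * \<epsilon> * \<gamma> * (1 - \<gamma>) \<le> a' s * G s - hamiltonian \<gamma> (a s) (G s)"
        using hamiltonian_tilt_le[OF \<gamma> \<epsilon>, of "a s"] by (simp add: G_def mult.commute)
    qed
    have F0: "F (a 0) = (1 + \<epsilon>) * ln (1 + \<epsilon>)"
    proof -
      have "(\<gamma> + \<epsilon> * \<gamma>) / \<gamma> = 1 + \<epsilon>" "(1 - \<gamma> + \<epsilon> * (1 - \<gamma>)) / (1 - \<gamma>) = 1 + \<epsilon>"
        using \<gamma> by (simp_all add: field_simps)
      then show ?thesis unfolding F_def a0 by (simp add: algebra_simps)
    qed
    \<comment> \<open>The added mass \<epsilon> y meets a ratio of at least \<epsilon>. Over y =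
      \<gamma> and y = 1-\<gamma> the losses add up to \<epsilon> ln \<epsilon>.\<close>
    have p: "x * ln (x / y) + \<epsilon> * y * ln \<epsilon> \<le> (x + \<epsilon> * y) * ln ((x + \<epsilon> * y) / y)"
      if "x \<ge> 0" "y > 0" for x y
    proof -
      have "ln \<epsilon> \<le> ln ((x + \<epsilon> * y) / y)"
        using that \<epsilon> by (intro ln_mono) (auto simp: field_simps)
      then have "\<epsilon> * y * ln \<epsilon> \<le> \<epsilon> * y * ln ((x + \<epsilon> * y) / y)"
        using that \<epsilon> by (intro mult_left_mono) auto
      with xlnx_perturb[OF that \<epsilon>] show ?thesis by (simp add: distrib_right)
    qed
    have "bernoulli_entropy \<gamma> ?m + \<epsilon> * ln \<epsilon> \<le> F ?m"
      using p[of ?m \<gamma>] p[of "1 - ?m" "1 - \<gamma>"] m \<gamma>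
      unfolding F_def bernoulli_entropy_def by (simp add: algebra_simps)
    then have "?r \<epsilon> \<le> J \<gamma> T G a" using J F0 by (simp add: mult.commute mult.left_commute)
    then show ?thesis using \<open>ereal (J \<gamma> T G a) \<le> rate \<gamma> T a\<close>
      by (meson ereal_less_eq(3) order_trans)
  qed
  have "(?r \<longlongrightarrow> bernoulli_entropy \<gamma> ?m) (at_right 0)"
    by real_asymp
  then have "((\<lambda>\<epsilon>. ereal (?r \<epsilon>)) \<longlongrightarrow> ereal (bernoulli_entropy \<gamma> ?m)) (at_right 0)"
    by simp
  then show ?thesis
  proof (rule tendsto_upperbound)
    show "\<forall>\<^sub>F \<epsilon> in at_right 0. ereal (?r \<epsilon>) \<le> rate \<gamma> T a"
      using eventually_at_right_less by (rule eventually_mono) (rule le)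
  qed simp
qed

lemma entropy_le_quasi_potential:
  assumes "0 < \<gamma>" "\<gamma> < 1"
  shows "ereal (bernoulli_entropy \<gamma> m) \<le> quasi_potential \<gamma> m"
  unfolding quasi_potential_def
proof (intro INF_greatest)
  fix T a assume T: "T \<in> {0<..}" and a: "a \<in> {a \<in> C1 T. (\<forall>s\<in>{0..T}. a s \<in> {0..1}) \<and> a T = m}"
  show "ereal (bernoulli_entropy \<gamma> m) \<le> rate_from \<gamma> T a"
    using entropy_le_rate[OF assms, of T a] T a by (auto simp: rate_from_def)
qed

section \<open>Continuity of the entropy and near-optimal paths\<close>

lemma continuous_on_xlnx: "continuous_on {0..} (\<lambda>x::real. x * ln x)"
  unfolding continuous_on_def
proof
  fix x :: real assume x: "x \<in> {0..}"
  show "((\<lambda>x. x * ln x) \<longlongrightarrow> x * ln x) (at x within {0..})"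
  proof (cases "x = 0")
    case True
    have "((\<lambda>x::real. x * ln x) \<longlongrightarrow> 0) (at_right 0)" by real_asymp
    then show ?thesis unfolding True by (simp add: at_within_Ici_at_right)
  next
    case False
    then have "isCont (\<lambda>x. x * ln x) x" by (intro continuous_intros) auto
    then show ?thesis unfolding isCont_def by (rule Lim_at_imp_Lim_at_within)
  qed
qed

text \<open>The end points are included because 0 ln 0 evaluates to 0, the correct limit. This
  serves paths that end at 0 or 1 and the approximation of these points from the interior.\<close>

lemma continuous_on_bernoulli_entropy:
  assumes "0 < \<gamma>" "\<gamma> < 1"
  shows "continuous_on {0..1} (bernoulli_entropy \<gamma>)"
proof -
  have x: "x * ln (x / y) = x * ln x - x * ln y" if "x \<ge> 0" "y > 0" for x y :: real
    using that by (cases "x = 0") (simp_all add: ln_div right_diff_distrib)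
  have c: "continuous_on {0..1} (\<lambda>m::real. m * ln m)"
    by (rule continuous_on_subset[OF continuous_on_xlnx]) auto
  have c': "continuous_on {0..1} (\<lambda>m::real. (1 - m) * ln (1 - m))"
    by (rule continuous_on_compose2[OF continuous_on_xlnx]) (auto intro!: continuous_intros)
  have "continuous_on {0..1} (\<lambda>m. (m * ln m - m * ln \<gamma>) + ((1 - m) * ln (1 - m) - (1 - m) * ln (1 - \<gamma>)))"
    by (intro continuous_on_add continuous_on_diff c c' continuous_intros)
  then show ?thesis
  proof (rule continuous_on_eq)
    fix m :: real assume "m \<in> {0..1}"
    then show "(m * ln m - m * ln \<gamma>) + ((1 - m) * ln (1 - m) - (1 - m) * ln (1 - \<gamma>)) = bernoulli_entropy \<gamma> m"
      unfolding bernoulli_entropy_def using x[of m \<gamma>] x[of "1 - m" "1 - \<gamma>"] assms by simp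
  qed
qed

text \<open>The supremum over q is attained at exp q = 1 + w/l, where the value is (l+w) ln (1 +
  w/l) - w; then ln z \<le> z - 1 gives w^2/l.\<close>

lemma exp_young:
  fixes w q l :: real
  assumes "l > 0" "\<bar>w\<bar> < l"
  shows "w * q - l * (exp q - 1 - q) \<le> w\<^sup>2 / l"
proof -
  define z where "z = 1 + w / l"
  have "- 1 < w / l" using assms by (simp add: pos_less_divide_eq)
  then have z: "z > 0" by (simp add: z_def)
  \<comment> \<open>The tangent line of exp at the maximiser q = ln z.\<close>
  have "z * (1 + (q - ln z)) \<le> z * exp (q - ln z)"
    using z by (intro mult_left_mono exp_ge_add_one_self) auto
  also have "\<dots> = exp q" using z by (simp add: exp_diff)
  finally have "l * (z * (1 + (q - ln z))) \<le> l * exp q" using assms by (intro mult_left_mono) auto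
  moreover have lz: "l * z = l + w" using assms by (simp add: z_def distrib_left)
  ultimately have 1: "(l + w) * (1 + (q - ln z)) \<le> l * exp q" by (metis mult.assoc)
  have "ln z \<le> w / l" using ln_le_minus_one[OF z] by (simp add: z_def)
  then have 2: "(l + w) * ln z \<le> (l + w) * (w / l)" using assms by (intro mult_left_mono) auto
  have "w * q - l * (exp q - 1 - q) = (l + w) * (1 + (q - ln z)) - l * exp q + (l + w) * ln z - w"
    by (simp add: algebra_simps)
  also have "\<dots> \<le> (l + w) * (w / l) - w" using 1 2 by linarith
  also have "\<dots> = w\<^sup>2 / l" using assms by (simp add: add_divide_distrib distrib_right power2_eq_square)
  finally show ?thesis .
qed

text \<open>The velocity 2(a-\<gamma>) is the reversed relaxation, for which p = z, the derivative
  of the entropy, is optimal. Writing p = z + q interchanges the two jump rates, and the part of q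
  that remains is a Young inequality in the velocity error w.\<close>

lemma lagrangian_bound:
  assumes \<gamma>: "0 < \<gamma>" "\<gamma> < 1" and a: "0 < a" "a < 1"
    and l: "l = min \<gamma> (1 - \<gamma>)" and w: "\<bar>w\<bar> < l" and v: "v = 2 * (a - \<gamma>) + w"
  shows "v * p - hamiltonian \<gamma> a p \<le> (ln (a / \<gamma>) - ln ((1 - a) / (1 - \<gamma>))) * v + w\<^sup>2 / l"
proof -
  define z where "z = ln (a / \<gamma>) - ln ((1 - a) / (1 - \<gamma>))"
  define q where "q = p - z"
  define A where "A = 2 * (1 - \<gamma>) * a"
  define B where "B = 2 * \<gamma> * (1 - a)"
  have l0: "l > 0" using \<gamma> l by simp
  have ez: "exp z = (a / \<gamma>) / ((1 - a) / (1 - \<gamma>))"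
    unfolding z_def using \<gamma> a by (simp add: exp_diff)
  have "B * exp p = A * exp q"
    unfolding q_def exp_diff ez A_def B_def using \<gamma> a by (simp add: field_simps)
  moreover have "A * exp (- p) = B * exp (- q)"
  proof -
    have "A * exp (- p) = A * exp q * (exp (- q) * exp (- p))" by (simp add: exp_minus)
    also have "\<dots> = B * exp p * (exp (- q) * exp (- p))" using \<open>B * exp p = A * exp q\<close> by simp
    also have "\<dots> = B * exp (- q)" by (simp add: exp_minus)
    finally show ?thesis .
  qed
  ultimately have H: "hamiltonian \<gamma> a p = A * (exp q - 1) + B * (exp (- q) - 1)"
    unfolding hamiltonian_def A_def[symmetric] B_def[symmetric] by (simp add: algebra_simps)
  have AB: "A - B = 2 * (a - \<gamma>)" by (simp add: A_def B_def algebra_simps)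
  have e1: "exp q - 1 - q \<ge> 0" and e2: "exp (- q) - 1 + q \<ge> 0"
    using exp_ge_add_one_self[of q] exp_ge_add_one_self[of "-q"] by linarith+
  have A0: "A \<ge> 0" "B \<ge> 0" using \<gamma> a by (auto simp: A_def B_def)
  \<comment> \<open>Near an end point one of the rates degenerates, but A \<ge> 1-\<gamma> for a
    \<ge> 1/2 and B \<ge> \<gamma> otherwise. The term with the good rate is kept, the other one has
    a sign.\<close>
  have "w * q - A * (exp q - 1 - q) - B * (exp (- q) - 1 + q) \<le> w\<^sup>2 / l"
  proof (cases "a \<ge> 1/2")
    case True
    have "(1 - \<gamma>) * 1 \<le> (1 - \<gamma>) * (2 * a)" using \<gamma> True by (intro mult_left_mono) auto
    moreover have "A = (1 - \<gamma>) * (2 * a)" by (simp add: A_def)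
    ultimately have "A \<ge> l" using l by simp
    then have "l * (exp q - 1 - q) \<le> A * (exp q - 1 - q)" using e1 by (rule mult_right_mono)
    moreover have "B * (exp (- q) - 1 + q) \<ge> 0" using A0 e2 by simp
    ultimately show ?thesis using exp_young[OF l0 w, of q] by linarith
  next
    case False
    have "\<gamma> * 1 \<le> \<gamma> * (2 * (1 - a))" using \<gamma> False by (intro mult_left_mono) auto
    moreover have "B = \<gamma> * (2 * (1 - a))" by (simp add: B_def)
    ultimately have "B \<ge> l" using l by simp
    then have "l * (exp (- q) - 1 + q) \<le> B * (exp (- q) - 1 + q)" using e2 by (rule mult_right_mono)
    moreover have "A * (exp q - 1 - q) \<ge> 0" using A0 e1 by simp
    moreover have "\<bar>- w\<bar> < l" using w by simp
    ultimately show ?thesis using exp_young[OF l0 \<open>\<bar>- w\<bar> < l\<close>, of "-q"] by simp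
  qed
  moreover have "v * p - hamiltonian \<gamma> a p = z * v + (w * q - A * (exp q - 1 - q) - B * (exp (- q) - 1 + q))"
  proof -
    have "v * p = z * v + (A - B + w) * q" unfolding q_def AB v by (simp add: algebra_simps)
    then show ?thesis unfolding H by (simp add: algebra_simps)
  qed
  ultimately show ?thesis by (simp add: z_def)
qed

text \<open>The optimal path is the time reversal of the relaxation \<open>a' = 2 (\<gamma> - a)\<close>; it leaves
  \<open>\<gamma>\<close> only in infinite time. Replacing the exponential by \<open>sinh\<close> lets it start from \<open>\<gamma>\<close>.\<close>

lemma quasi_potential_le_entropy:
  assumes \<gamma>: "0 < \<gamma>" "\<gamma> < 1" and m: "m \<in> {0..1}"
  shows "quasi_potential \<gamma> m \<le> ereal (bernoulli_entropy \<gamma> m)"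
proof (rule ereal_le_epsilon2)
  fix e :: real assume e: "e > 0"
  define l where "l = min \<gamma> (1 - \<gamma>)"
  have l0: "l > 0" using \<gamma> by (simp add: l_def)
  \<comment> \<open>The velocity error along the path is at most 2 / sinh (2T). It has to stay below
    l for \<open>lagrangian_bound\<close>, and its cost over time T has to stay below e.\<close>
  have "((\<lambda>T::real. 2 / sinh (2 * T)) \<longlongrightarrow> 0) at_top" by real_asymp
  then have ev1: "\<forall>\<^sub>F T in at_top. 2 / sinh (2 * T) < l" by (rule order_tendstoD) (rule l0)
  have "((\<lambda>T::real. T * (2 / sinh (2 * T))\<^sup>2 / l) \<longlongrightarrow> 0) at_top"
    using l0 by real_asymp
  then have ev2: "\<forall>\<^sub>F T in at_top. T * (2 / sinh (2 * T))\<^sup>2 / l < e" by (rule order_tendstoD) (rule e)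
  obtain T where T: "T > 0" "2 / sinh (2 * T) < l" "T * (2 / sinh (2 * T))\<^sup>2 / l < e"
    using eventually_happens[OF eventually_conj[OF eventually_gt_at_top[of "0::real"] eventually_conj[OF ev1 ev2]]]
    by auto
  define r where "r = 2 / sinh (2 * T)"
  have sT: "sinh (2 * T) > 0" using T by simp
  define \<phi> where "\<phi> s = sinh (2 * s) / sinh (2 * T)" for s
  define a where "a s = \<gamma> + (m - \<gamma>) * \<phi> s" for s
  define a' where "a' s = (m - \<gamma>) * (2 * cosh (2 * s) / sinh (2 * T))" for s
  have \<phi>: "0 \<le> \<phi> s \<and> \<phi> s \<le> 1" if "s \<in> {0..T}" for s
    using that sT by (simp add: \<phi>_def divide_simps)
  have \<phi>': "0 < \<phi> s \<and> \<phi> s < 1" if "s \<in> {0<..<T}" for s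
    using that sT by (simp add: \<phi>_def divide_simps)
  have conv: "a s = (1 - \<phi> s) * \<gamma> + \<phi> s * m" for s by (simp add: a_def algebra_simps)
  have a01: "a s \<in> {0..1}" if "s \<in> {0..T}" for s
  proof -
    have "(1 - \<phi> s) * \<gamma> \<le> (1 - \<phi> s) * 1" "\<phi> s * m \<le> \<phi> s * 1"
      using \<phi>[OF that] \<gamma> m by (auto intro!: mult_left_le)
    moreover have "0 \<le> (1 - \<phi> s) * \<gamma>" "0 \<le> \<phi> s * m" using \<phi>[OF that] \<gamma> m by auto
    ultimately show ?thesis unfolding conv by auto
  qed
  have a01': "0 < a s \<and> a s < 1" if "s \<in> {0<..<T}" for s
  proof -
    have "(1 - \<phi> s) * \<gamma> < 1 - \<phi> s" using \<phi>'[OF that] \<gamma> by simp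
    moreover have "\<phi> s * m \<le> \<phi> s" using \<phi>'[OF that] m by (auto intro!: mult_left_le)
    moreover have "0 < (1 - \<phi> s) * \<gamma>" "0 \<le> \<phi> s * m" using \<phi>'[OF that] \<gamma> m by auto
    ultimately show ?thesis unfolding conv by (simp add: add_pos_nonneg)
  qed
  have da: "(a has_real_derivative a' s) (at s within A)" for s A
    unfolding a_def a'_def \<phi>_def
    using T(1) by (auto intro!: derivative_eq_intros)
  have ca': "continuous_on A a'" for A
    unfolding a'_def using sT by (intro continuous_intros) auto
  have ca: "continuous_on A a" for A
    using da DERIV_continuous_on by blast
  have aC: "a \<in> C1 T" unfolding C1_def using ca' da by blast
  have a0: "a 0 = \<gamma>" by (simp add: a_def \<phi>_def)
  have aT: "a T = m" using sT by (simp add: a_def \<phi>_def)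
  define D where "D s = (ln (a s / \<gamma>) - ln ((1 - a s) / (1 - \<gamma>))) * a' s" for s
  \<comment> \<open>If m is 0 or 1, the entropy has no derivative at the final point; the interior
    version of the fundamental theorem needs only continuity there.\<close>
  have "(D has_integral (bernoulli_entropy \<gamma> (a T) - bernoulli_entropy \<gamma> (a 0))) {0..T}"
  proof (rule fundamental_theorem_of_calculus_interior)
    show "continuous_on {0..T} (\<lambda>s. bernoulli_entropy \<gamma> (a s))"
      using a01 by (intro continuous_on_compose2[OF continuous_on_bernoulli_entropy[OF \<gamma>] ca]) auto
    fix s assume s: "s \<in> {0<..<T}"
    have "(bernoulli_entropy \<gamma> has_real_derivative ln (a s / \<gamma>) - ln ((1 - a s) / (1 - \<gamma>))) (at (a s))"
      unfolding bernoulli_entropy_def using a01'[OF s] \<gamma>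
      by (auto intro!: derivative_eq_intros simp: divide_simps) (simp add: algebra_simps)
    from DERIV_chain2[OF this da]
    show "((\<lambda>s. bernoulli_entropy \<gamma> (a s)) has_vector_derivative D s) (at s)"
      by (simp add: D_def has_real_derivative_iff_has_vector_derivative)
  qed (use T in simp)
  moreover have "bernoulli_entropy \<gamma> (a 0) = 0"
    unfolding a0 bernoulli_entropy_def using \<gamma> by simp
  ultimately have ID: "(D has_integral bernoulli_entropy \<gamma> m) {0..T}" by (simp add: aT)
  have IR: "((\<lambda>s. D s + r\<^sup>2 / l) has_integral (bernoulli_entropy \<gamma> m + T * (r\<^sup>2 / l))) {0..T}"
    using has_integral_const_real[of "r\<^sup>2 / l" 0 T] T by (intro has_integral_add[OF ID]) simp
  have "rate \<gamma> T a \<le> ereal (bernoulli_entropy \<gamma> m + e)"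
    unfolding rate_def
  proof (rule SUP_least)
    fix G assume G: "G \<in> C1 T"
    have "J \<gamma> T G a \<le> bernoulli_entropy \<gamma> m + T * (r\<^sup>2 / l)"
    proof (rule has_integral_le)
      show "((\<lambda>s. a' s * G s - hamiltonian \<gamma> (a s) (G s)) has_integral J \<gamma> T G a) {0<..<T}"
        using J_has_integral[OF T(1) ca' da G] by (simp add: has_integral_Icc_iff_Ioo)
      show "((\<lambda>s. D s + r\<^sup>2 / l) has_integral (bernoulli_entropy \<gamma> m + T * (r\<^sup>2 / l))) {0<..<T}"
        using IR by (simp add: has_integral_Icc_iff_Ioo)
      fix s assume s: "s \<in> {0<..<T}"
      define w where "w = a' s - 2 * (a s - \<gamma>)"
      \<comment> \<open>cosh - sinh is a decaying exponential, so the \<open>sinh\<close> path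
        nearly has the reversed velocity.\<close>
      have "w = (m - \<gamma>) * (exp (- (2 * s)) * r)"
        unfolding w_def a'_def a_def \<phi>_def r_def cosh_minus_sinh[symmetric] using sT
        by (simp add: field_simps)
      then have "\<bar>w\<bar> = \<bar>m - \<gamma>\<bar> * (exp (- (2 * s)) * r)" using sT by (simp add: abs_mult r_def)
      also have "\<dots> \<le> 1 * (1 * r)"
        using m \<gamma> s sT by (intro mult_mono) (auto simp: r_def)
      finally have w: "\<bar>w\<bar> \<le> r" by simp
      then have "w\<^sup>2 \<le> r\<^sup>2" using sT by (intro abs_le_square_iff[THEN iffD1]) (simp add: r_def)
      then have "w\<^sup>2 / l \<le> r\<^sup>2 / l" using l0 by (simp add: divide_right_mono)
      moreover have "a' s * G s - hamiltonian \<gamma> (a s) (G s) \<le> D s + w\<^sup>2 / l"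
        unfolding D_def using a01'[OF s] w T(2)
        by (intro lagrangian_bound[OF \<gamma> _ _ l_def]) (auto simp: w_def r_def)
      ultimately show "a' s * G s - hamiltonian \<gamma> (a s) (G s) \<le> D s + r\<^sup>2 / l" by linarith
    qed
    then show "ereal (J \<gamma> T G a) \<le> ereal (bernoulli_entropy \<gamma> m + e)"
      using T(3) by (simp add: r_def)
  qed
  then have "rate_from \<gamma> T a \<le> ereal (bernoulli_entropy \<gamma> m) + ereal e" by (simp add: rate_from_def a0)
  moreover have "quasi_potential \<gamma> m \<le> rate_from \<gamma> T a"
    unfolding quasi_potential_def using T(1) aC a01 aT
    by (intro INF_lower2[of T] INF_lower) auto
  ultimately show "quasi_potential \<gamma> m \<le> ereal (bernoulli_entropy \<gamma> m) + ereal e" by order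
qed

lemma quasi_potential_eq_entropy:
  assumes "0 < \<gamma>" "\<gamma> < 1" "m \<in> {0..1}"
  shows "quasi_potential \<gamma> m = ereal (bernoulli_entropy \<gamma> m)"
  using entropy_le_quasi_potential quasi_potential_le_entropy assms by (intro antisym) auto

section \<open>Duality\<close>

abbreviation (input) swap :: "nat \<Rightarrow> nat \<Rightarrow> nat \<Rightarrow> nat" where
  "swap \<equiv> Transposition.transpose"

text \<open>The correlations of \<open>\<eta> - b\<close> solve the equations of a dual exclusion process whose
  particles are absorbed beyond the sites \<open>1\<close> and \<open>N - 1\<close>, with absorption values
  \<open>a = \<alpha> - b\<close> and \<open>c = \<beta> - b\<close>.\<close>

definition dual_system :: "nat \<Rightarrow> real \<Rightarrow> real \<Rightarrow> (nat set \<Rightarrow> real) \<Rightarrow> bool" where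
  "dual_system N a c \<phi> \<longleftrightarrow> (\<forall>A\<subseteq>{1..N-1}.
     (real N)\<^sup>2 * (\<Sum>x = 1..N-2. \<phi> (swap x (x+1) ` A) - \<phi> A)
     + (if 1 \<in> A then a * \<phi> (A - {1}) - \<phi> A else 0)
     + (if N-1 \<in> A then c * \<phi> (A - {N-1}) - \<phi> A else 0) = 0)"

section \<open>Transpositions of sites and uniqueness for the dual system\<close>

lemma mem_image_transpose: "z \<in> swap x y ` A \<longleftrightarrow> swap x y z \<in> A"
  by (metis image_iff Transposition.transpose_involutory)

lemma image_transpose_eq:
  assumes "x \<in> A \<longleftrightarrow> y \<in> A"
  shows "swap x y ` A = A"
proof (rule set_eqI)
  fix z
  show "z \<in> swap x y ` A \<longleftrightarrow> z \<in> A"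
    unfolding mem_image_transpose using assms by (cases "z = x"; cases "z = y") auto
qed

lemma image_transpose_only:
  assumes "x \<in> A" "y \<notin> A"
  shows "swap x y ` A = insert y (A - {x})"
proof (rule set_eqI)
  fix z
  show "z \<in> swap x y ` A \<longleftrightarrow> z \<in> insert y (A - {x})"
    unfolding mem_image_transpose using assms by (cases "z = x"; cases "z = y") auto
qed

lemma image_transpose_subset:
  assumes "A \<subseteq> S" "x \<in> S" "y \<in> S"
  shows "swap x y ` A \<subseteq> S"
  using assms by (auto simp: Transposition.transpose_def)

lemma card_image_transpose [simp]: "card (swap x y ` A) = card A"
  by (rule card_image) simp

text \<open>Where |d| is maximal, the equation forces all neighbouring sets to be maximal too and
  excludes the sites 1 and N-1. The rightmost particle can therefore always hop to the right, which
  contradicts finiteness.\<close>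

lemma dual_system_max_principle:
  fixes d :: "nat set \<Rightarrow> real"
  assumes N: "N \<ge> 3"
    and eq: "\<And>A. A \<subseteq> {1..N-1} \<Longrightarrow> card A = n \<Longrightarrow>
      (real N)\<^sup>2 * (\<Sum>x = 1..N-2. d (swap x (x+1) ` A) - d A)
      - (if 1 \<in> A then d A else 0) - (if N-1 \<in> A then d A else 0) = 0"
    and n: "n > 0" and B: "B \<subseteq> {1..N-1}" "card B = n"
  shows "d B = 0"
proof (rule ccontr)
  assume dB: "d B \<noteq> 0"
  define \<A> where "\<A> = {A. A \<subseteq> {1..N-1} \<and> card A = n}"
  have fin: "finite \<A>" by (rule finite_subset[of _ "Pow {1..N-1}"]) (auto simp: \<A>_def)
  have BA: "B \<in> \<A>" using B by (simp add: \<A>_def)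
  define M where "M = Max ((\<lambda>A. \<bar>d A\<bar>) ` \<A>)"
  have M: "\<bar>d A\<bar> \<le> M" if "A \<in> \<A>" for A
    using fin that by (simp add: M_def)
  have "M \<in> (\<lambda>A. \<bar>d A\<bar>) ` \<A>"
    unfolding M_def using fin BA by (intro Max_in) auto
  then obtain A0 where A0: "A0 \<in> \<A>" "\<bar>d A0\<bar> = M" by auto
  define \<B> where "\<B> = {A\<in>\<A>. \<bar>d A\<bar> = M}"
  have finB: "finite \<B>" using fin by (simp add: \<B>_def)
  \<comment> \<open>Among the maximal sets one with the largest sum of sites is taken; a hop to the
    right has to leave this class.\<close>
  have "Max ((\<lambda>A. \<Sum>A) ` \<B>) \<in> (\<lambda>A. \<Sum>A) ` \<B>"
    using A0 finB by (intro Max_in) (auto simp: \<B>_def)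
  then obtain A where A: "A \<in> \<B>" "\<Sum>A = Max ((\<lambda>A. \<Sum>A) ` \<B>)" by auto
  have Amax: "\<Sum>C \<le> \<Sum>A" if "C \<in> \<B>" for C
    using A(2) finB that by simp
  have AA: "A \<subseteq> {1..N-1}" "card A = n" "\<bar>d A\<bar> = M"
    using A(1) by (auto simp: \<B>_def \<A>_def)
  have "M > 0" using M[OF BA] dB by linarith
  then have dA: "d A \<noteq> 0" using AA by auto
  have tr: "swap x (x+1) ` A \<in> \<A>" if "x \<in> {1..N-2}" for x
  proof -
    have "swap x (x+1) ` A \<subseteq> {1..N-1}"
      using that N by (intro image_transpose_subset[OF AA(1)]) auto
    then show ?thesis unfolding \<A>_def using AA(2) by (simp only: mem_Collect_eq card_image_transpose)
  qed
  \<comment> \<open>Deficits against the maximum, oriented by the sign of \<open>d A\<close>: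
    together with the boundary terms they are nonnegative and add up to zero.\<close>
  define e where "e x = \<bar>d A\<bar> - sgn (d A) * d (swap x (x+1) ` A)" for x
  have e0: "e x \<ge> 0" if "x \<in> {1..N-2}" for x
  proof -
    have "sgn (d A) * d (swap x (x+1) ` A) \<le> \<bar>d (swap x (x+1) ` A)\<bar>"
      by (auto simp: sgn_if)
    also have "\<dots> \<le> M" using M[OF tr[OF that]] .
    finally show ?thesis using AA(3) by (simp add: e_def)
  qed
  have "(\<Sum>x = 1..N-2. e x) = - sgn (d A) * (\<Sum>x = 1..N-2. d (swap x (x+1) ` A) - d A)"
    unfolding e_def sum_distrib_left by (intro sum.cong) (auto simp: right_diff_distrib sgn_if)
  then have "(real N)\<^sup>2 * (\<Sum>x = 1..N-2. e x)
      = - sgn (d A) * ((if 1 \<in> A then d A else 0) + (if N-1 \<in> A then d A else 0))"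
    using eq[OF AA(1,2)] by (simp add: algebra_simps split: if_splits)
  also have "\<dots> = - ((if 1 \<in> A then \<bar>d A\<bar> else 0) + (if N-1 \<in> A then \<bar>d A\<bar> else 0))"
    by (auto simp: sgn_if)
  finally have key: "(real N)\<^sup>2 * (\<Sum>x = 1..N-2. e x)
      + ((if 1 \<in> A then \<bar>d A\<bar> else 0) + (if N-1 \<in> A then \<bar>d A\<bar> else 0)) = 0" by simp
  have S0: "(\<Sum>x = 1..N-2. e x) \<ge> 0" using e0 by (intro sum_nonneg) auto
  then have S1: "(real N)\<^sup>2 * (\<Sum>x = 1..N-2. e x) \<ge> 0" by simp
  have N1: "N - 1 \<notin> A"
  proof
    assume "N - 1 \<in> A"
    then show False using key S1 dA by (cases "1 \<in> A") simp_all
  qed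
  have "1 \<notin> A"
  proof
    assume "1 \<in> A"
    then show False using key S1 dA N1 by simp
  qed
  then have "(real N)\<^sup>2 * (\<Sum>x = 1..N-2. e x) = 0"
    using key N1 by simp
  then have "(\<Sum>x = 1..N-2. e x) = 0" using N by simp
  then have ez: "e x = 0" if "x \<in> {1..N-2}" for x
    using that e0 sum_nonneg_eq_0_iff[of "{1..N-2}" e] by auto
  have finA: "finite A" using AA(1) finite_subset by blast
  have Ane: "A \<noteq> {}" using n AA(2) by auto
  define x where "x = Max A"
  have xA: "x \<in> A" using finA Ane by (simp add: x_def)
  then have "1 \<le> x" "x \<le> N - 1" "x \<noteq> N - 1" using AA(1) N1 by auto
  then have x: "x \<in> {1..N-2}" by simp
  have x1: "x + 1 \<notin> A" using Max_ge[OF finA, of "x+1"] unfolding x_def by fastforce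
  let ?C = "swap x (x+1) ` A"
  have C: "?C = insert (x+1) (A - {x})" using image_transpose_only[OF xA x1] .
  have "sgn (d A) * d ?C = \<bar>d A\<bar>" using ez[OF x] by (simp add: e_def)
  then have "\<bar>d ?C\<bar> = M" using AA(3) dA by (auto simp: sgn_if split: if_splits)
  then have "?C \<in> \<B>" using tr[OF x] by (simp add: \<B>_def)
  from Amax[OF this] have "\<Sum>?C \<le> \<Sum>A" .
  moreover have "\<Sum>?C = (x + 1) + \<Sum>(A - {x})" unfolding C using finA x1 by simp
  moreover have "\<Sum>A = x + \<Sum>(A - {x})" using finA xA by (simp add: sum.remove)
  ultimately show False by simp
qed

text \<open>Absorption lowers the cardinality. By induction the difference of two solutions vanishes
  on smaller sets and solves the homogeneous equation on the current level; the value at the empty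
  set starts the induction.\<close>

lemma dual_system_unique:
  assumes N: "N \<ge> 3" and "dual_system N a c \<phi>" "dual_system N a c \<psi>" and empty: "\<phi> {} = \<psi> {}"
    and "A \<subseteq> {1..N-1}"
  shows "\<phi> A = \<psi> A"
proof -
  define d where "d A = \<phi> A - \<psi> A" for A
  have sys: "(real N)\<^sup>2 * (\<Sum>x = 1..N-2. d (swap x (x+1) ` A) - d A)
     + (if 1 \<in> A then a * d (A - {1}) - d A else 0)
     + (if N-1 \<in> A then c * d (A - {N-1}) - d A else 0) = 0" if "A \<subseteq> {1..N-1}" for A
  proof -
    have s: "(\<Sum>x = 1..N-2. d (swap x (x+1) ` A) - d A)
      = (\<Sum>x = 1..N-2. \<phi> (swap x (x+1) ` A) - \<phi> A)
       - (\<Sum>x = 1..N-2. \<psi> (swap x (x+1) ` A) - \<psi> A)"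
      unfolding sum_subtractf[symmetric] d_def by (rule sum.cong) auto
    show ?thesis
      using assms(2)[unfolded dual_system_def, rule_format, OF that]
        assms(3)[unfolded dual_system_def, rule_format, OF that]
      unfolding s unfolding right_diff_distrib d_def by (auto split: if_splits)
  qed
  have "d A = 0" if "A \<subseteq> {1..N-1}" "card A = n" for n A
    using that
  proof (induction n arbitrary: A)
    case 0
    then have "A = {}" using finite_subset by fastforce
    then show ?case using empty by (simp add: d_def)
  next
    case (Suc n)
    show ?case
    proof (rule dual_system_max_principle[OF N _ _ Suc.prems])
      fix B assume B: "B \<subseteq> {1..N-1}" "card B = Suc n"
      have "d (B - {y}) = 0" if "y \<in> B" for y
        using B that by (intro Suc.IH) (auto simp: card_Diff_singleton)
      then show "(real N)\<^sup>2 * (\<Sum>x = 1..N-2. d (swap x (x+1) ` B) - d B)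
        - (if 1 \<in> B then d B else 0) - (if N-1 \<in> B then d B else 0) = 0"
        using sys[OF B(1)] by (simp split: if_splits)
    qed simp
  qed
  from this[OF assms(5) refl] show ?thesis by (simp add: d_def)
qed

text \<open>\<open>dual_solution N A\<close> is the probability that all dual particles started from \<open>A\<close> are
  absorbed on the left. It factorises once each position is shifted by the number of particles
  to its right.\<close>

definition dual_factor :: "nat \<Rightarrow> nat set \<Rightarrow> nat \<Rightarrow> real" where
  "dual_factor N A x = (real N)\<^sup>2 + real N - 1 - real x - real (card {y\<in>A. y > x})"

definition dual_solution :: "nat \<Rightarrow> nat set \<Rightarrow> real" where
  "dual_solution N A =
     (\<Prod>x\<in>A. dual_factor N A x) / (\<Prod>i = 1..card A. 2 * (real N)\<^sup>2 + real N - 1 - real i)"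

text \<open>A hop to an empty neighbour preserves the order of the particles, so no particle sees a
  different number to its right and only the position of the moving one changes.\<close>

lemma dual_factor_move:
  assumes "finite A" "x \<in> A" "x + 1 \<notin> A"
  defines "B \<equiv> insert (x+1) (A - {x})"
  shows "z \<in> A - {x} \<Longrightarrow> dual_factor N B z = dual_factor N A z"
    and "dual_factor N B (x+1) = dual_factor N A x - 1"
proof -
  show "dual_factor N B z = dual_factor N A z" if z: "z \<in> A - {x}"
  proof (cases "z < x")
    case True
    then have "{y\<in>B. y > z} = insert (x+1) ({y\<in>A. y > z} - {x})"
      using assms by auto
    moreover have "card (insert (x+1) ({y\<in>A. y > z} - {x})) = Suc (card ({y\<in>A. y > z} - {x}))"
      using assms(1,3) by (intro card_insert_disjoint) auto
    moreover have "card {y\<in>A. y > z} = Suc (card ({y\<in>A. y > z} - {x}))"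
      using assms(1,2) True by (intro card.remove) auto
    ultimately show ?thesis by (simp add: dual_factor_def)
  next
    case False
    then have "z > x + 1" using z assms by (metis DiffE Suc_eq_plus1 less_antisym linorder_neqE_nat singletonI)
    then have "{y\<in>B. y > z} = {y\<in>A. y > z}" using assms by auto
    then show ?thesis by (simp add: dual_factor_def)
  qed
  have "{y\<in>B. y > x+1} = {y\<in>A. y > x}"
  proof (rule set_eqI)
    fix y
    have "y \<noteq> x + 1" if "y \<in> A" using that assms(3) by auto
    then show "y \<in> {y\<in>B. y > x+1} \<longleftrightarrow> y \<in> {y\<in>A. y > x}"
      unfolding B_def by auto
  qed
  then show "dual_factor N B (x+1) = dual_factor N A x - 1"
    by (simp add: dual_factor_def)
qed

text \<open>Each bond contributes a discrete gradient of the product with one site left out, so that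
  the sum over the bonds telescopes.\<close>

lemma prod_dual_factor_swap:
  assumes "finite A"
  shows "(\<Prod>z\<in>swap x (x+1) ` A. dual_factor N (swap x (x+1) ` A) z) - (\<Prod>z\<in>A. dual_factor N A z)
    = (if x+1 \<in> A then \<Prod>z\<in>A-{x+1}. dual_factor N A z else 0)
      - (if x \<in> A then \<Prod>z\<in>A-{x}. dual_factor N A z else 0)"
proof -
  consider "x \<in> A" "x+1 \<in> A" | "x \<notin> A" "x+1 \<notin> A" | "x \<in> A" "x+1 \<notin> A" | "x \<notin> A" "x+1 \<in> A"
    by blast
  then show ?thesis
  proof cases
    case 1
    \<comment> \<open>Adjacent particles have equal factors: position plus number of particles to
      the right is the same for both. Hence both sides are zero.\<close>
    have "{y\<in>A. y > x} = insert (x+1) {y\<in>A. y > x+1}" using 1 by auto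
    then have "dual_factor N A x = dual_factor N A (x+1)"
      using assms by (simp add: dual_factor_def)
    moreover have "(\<Prod>z\<in>A-{x+1}. dual_factor N A z) = dual_factor N A x * (\<Prod>z\<in>A-{x+1}-{x}. dual_factor N A z)"
      using assms 1 by (intro prod.remove) auto
    moreover have "(\<Prod>z\<in>A-{x}. dual_factor N A z) = dual_factor N A (x+1) * (\<Prod>z\<in>A-{x}-{x+1}. dual_factor N A z)"
      using assms 1 by (intro prod.remove) auto
    moreover have "A-{x}-{x+1} = A-{x+1}-{x}" by auto
    ultimately show ?thesis using 1 by (simp add: image_transpose_eq)
  next
    case 2
    then show ?thesis by (simp add: image_transpose_eq)
  next
    case 3
    let ?B = "insert (x+1) (A - {x})"
    have "(\<Prod>z\<in>?B. dual_factor N ?B z) = dual_factor N ?B (x+1) * (\<Prod>z\<in>A-{x}. dual_factor N ?B z)"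
      using assms 3 by simp
    also have "\<dots> = (dual_factor N A x - 1) * (\<Prod>z\<in>A-{x}. dual_factor N A z)"
      using dual_factor_move[OF assms 3] by simp
    also have "\<dots> = (\<Prod>z\<in>A. dual_factor N A z) - (\<Prod>z\<in>A-{x}. dual_factor N A z)"
      using assms 3 by (simp add: prod.remove[of A x] algebra_simps)
    finally show ?thesis using 3 by (simp add: image_transpose_only)
  next
    case 4
    \<comment> \<open>The reverse hop: A arises from \<open>?B\<close> by the move of
      \<open>dual_factor_move\<close>, so the factor grows by 1.\<close>
    let ?B = "insert x (A - {x+1})"
    have B: "finite ?B" "x \<in> ?B" "x+1 \<notin> ?B" using assms by auto
    have A: "insert (x+1) (?B - {x}) = A" and d: "?B - {x} = A - {x+1}" using 4 by auto
    note mv = dual_factor_move[OF B, unfolded A]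
    have "(\<Prod>z\<in>?B. dual_factor N ?B z) = dual_factor N ?B x * (\<Prod>z\<in>A-{x+1}. dual_factor N ?B z)"
      using assms 4 by simp
    also have "(\<Prod>z\<in>A-{x+1}. dual_factor N ?B z) = (\<Prod>z\<in>A-{x+1}. dual_factor N A z)"
      using mv(1)[unfolded d] by (intro prod.cong) auto
    also have "dual_factor N ?B x = dual_factor N A (x+1) + 1"
      using mv(2)[of N] by simp
    also have "(dual_factor N A (x+1) + 1) * (\<Prod>z\<in>A-{x+1}. dual_factor N A z) = (\<Prod>z\<in>A. dual_factor N A z) + (\<Prod>z\<in>A-{x+1}. dual_factor N A z)"
      using assms 4 by (simp add: prod.remove[of A "x+1"] algebra_simps)
    finally have "(\<Prod>z\<in>?B. dual_factor N ?B z) = \<dots>" .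
    moreover have "swap x (x+1) ` A = ?B"
      using image_transpose_only[of "x+1" A x] 4 by (simp add: Transposition.transpose_commute)
    ultimately show ?thesis using 4 by simp
  qed
qed

lemma dual_solution_denom_pos:
  assumes "N \<ge> 3" "n \<le> N - 1"
  shows "(\<Prod>i = 1..n. 2 * (real N)\<^sup>2 + real N - 1 - real i) > 0"
proof (intro prod_pos)
  fix i assume "i \<in> {1..n}"
  then have "real i \<le> real N - 1" using assms by auto
  moreover have "(real N)\<^sup>2 > 0" using assms by simp
  ultimately show "0 < 2 * (real N)\<^sup>2 + real N - 1 - real i" by linarith
qed

text \<open>After telescoping only the two end sites remain, and each boundary term cancels its end:
  the factor of N-1 is exactly N^2, and the factor of 1 is the last denominator factor minus
  N^2.\<close>

lemma dual_system_solution: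
  assumes N: "N \<ge> 3"
  shows "dual_system N a 0 (\<lambda>A. a ^ card A * dual_solution N A)"
  unfolding dual_system_def
proof (intro allI impI)
  fix A assume A: "A \<subseteq> {1..N-1}"
  then have fin: "finite A" using finite_subset by blast
  let ?n = "card A"
  define den where "den n = (\<Prod>i = 1..n. 2 * (real N)\<^sup>2 + real N - 1 - real i)" for n
  define num where "num A = (\<Prod>x\<in>A. dual_factor N A x)" for A
  define P where "P y = (if y \<in> A then \<Prod>z\<in>A-{y}. dual_factor N A z else 0)" for y
  have cardle: "?n \<le> N - 1" using card_mono[OF _ A] by simp
  have den0: "den n > 0" if "n \<le> N - 1" for n
    using dual_solution_denom_pos[OF N that] by (simp add: den_def)
  have sol: "dual_solution N B = num B / den (card B)" for B
    by (simp add: dual_solution_def num_def den_def)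
  have "(\<Sum>x = 1..N-2. num (swap x (x+1) ` A) - num A) = (\<Sum>x = 1..N-2. P (x+1) - P x)"
    unfolding num_def P_def using prod_dual_factor_swap[OF fin] by simp
  also have "\<dots> = P (N-1) - P 1"
    using sum_Suc_diff[of 1 "N-2" P] N by (simp add: numeral_2_eq_2 Suc_diff_Suc)
  finally have bulk: "(\<Sum>x = 1..N-2. num (swap x (x+1) ` A) - num A) = P (N-1) - P 1" .
  have s: "(\<Sum>x = 1..N-2. a ^ card (swap x (x+1) ` A) * dual_solution N (swap x (x+1) ` A)
          - a ^ ?n * dual_solution N A) = a ^ ?n / den ?n * (P (N-1) - P 1)"
    unfolding bulk[symmetric] sum_distrib_left sol card_image_transpose
    by (intro sum.cong) (auto simp: right_diff_distrib diff_divide_distrib)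
  have right: "num A = (real N)\<^sup>2 * P (N-1)" if "N-1 \<in> A"
  proof -
    have "{y\<in>A. y > N-1} = {}" using A by auto
    then have "dual_factor N A (N-1) = (real N)\<^sup>2"
      unfolding dual_factor_def \<open>{y\<in>A. y > N-1} = {}\<close> using N by (simp add: of_nat_diff)
    then show ?thesis using that fin by (simp add: num_def P_def prod.remove[of A "N-1"])
  qed
  \<comment> \<open>All other n - 1 particles are to the right of site 1, so its factor is N^2 + N -
    1 - 1 - (n - 1).\<close>
  have left: "num A = ((real N)\<^sup>2 + real N - 1 - real ?n) * P 1"
       "num (A - {1}) = P 1" "?n > 0" if "1 \<in> A"
  proof -
    have e: "{y\<in>A. y > 1} = A - {1}" using A by force
    show n0: "?n > 0" using that fin by (auto simp: card_gt_0_iff)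
    have "dual_factor N A 1 = (real N)\<^sup>2 + real N - 1 - real ?n"
      unfolding dual_factor_def e using that n0 by (simp add: card_Diff_singleton of_nat_diff)
    then show "num A = ((real N)\<^sup>2 + real N - 1 - real ?n) * P 1"
      using that fin by (simp add: num_def P_def prod.remove[of A 1])
    have "dual_factor N (A - {1}) z = dual_factor N A z" if "z \<in> A - {1}" for z
    proof -
      have "{y\<in>A-{1}. y > z} = {y\<in>A. y > z}" using A that by force
      then show ?thesis by (simp add: dual_factor_def)
    qed
    then show "num (A - {1}) = P 1" using that by (simp add: num_def P_def)
  qed
  have L: "(if 1 \<in> A then a * (a ^ card (A - {1}) * dual_solution N (A - {1})) - a ^ ?n * dual_solution N A else 0)
     = (real N)\<^sup>2 * (a ^ ?n / den ?n * P 1)"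
  proof (cases "1 \<in> A")
    case True
    obtain k where k: "?n = Suc k" using left(3)[OF True] by (cases ?n) auto
    define q where "q = 2 * (real N)\<^sup>2 + real N - 1 - real ?n"
    have den: "den ?n = den k * q" by (simp add: den_def k q_def)
    have "den ?n > 0" "den k > 0" using den0 cardle k by auto
    then have "q \<noteq> 0" "den k \<noteq> 0" using den by auto
    have num: "num A = (q - (real N)\<^sup>2) * P 1" using left(1)[OF True] by (simp add: q_def)
    have "a * (a ^ k * (P 1 / den k)) - a ^ Suc k * (num A / (den k * q))
        = (real N)\<^sup>2 * (a ^ Suc k / (den k * q) * P 1)"
      unfolding num using \<open>q \<noteq> 0\<close> \<open>den k \<noteq> 0\<close> by (simp add: divide_simps) (simp add: algebra_simps)
    moreover have "card (A - {1}) = k" using k True by simp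
    ultimately show ?thesis using True left(2)[OF True] den
      by (simp add: sol k)
  qed (simp add: P_def)
  have R: "(if N-1 \<in> A then 0 * (a ^ card (A - {N-1}) * dual_solution N (A - {N-1})) - a ^ ?n * dual_solution N A else 0)
     = - (real N)\<^sup>2 * (a ^ ?n / den ?n * P (N-1))"
    using right by (auto simp: sol P_def)
  show "(real N)\<^sup>2 * (\<Sum>x = 1..N-2. a ^ card (swap x (x+1) ` A) * dual_solution N (swap x (x+1) ` A)
          - a ^ ?n * dual_solution N A) +
        (if 1 \<in> A then a * (a ^ card (A - {1}) * dual_solution N (A - {1})) - a ^ ?n * dual_solution N A else 0) +
        (if N-1 \<in> A then 0 * (a ^ card (A - {N-1}) * dual_solution N (A - {N-1})) - a ^ ?n * dual_solution N A else 0) = 0"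
    unfolding s L R by (simp add: algebra_simps)
qed

text \<open>Position plus number of particles to the right is at most N-1, so every numerator factor
  lies between N^2 and N^2 + N, and every denominator factor between 2 N^2 and 2 N^2 + N.\<close>

lemma dual_solution_bounds:
  assumes N: "N \<ge> 3" and A: "A \<subseteq> {1..N-1}"
  shows "((1 - 1 / real N) / 2) ^ card A \<le> dual_solution N A"
    and "dual_solution N A \<le> ((1 + 1 / real N) / 2) ^ card A"
proof -
  have fin: "finite A" using A finite_subset by blast
  let ?n = "card A"
  have cardle: "?n \<le> N - 1" using card_mono[OF _ A] by simp
  have N0: "real N > 0" "(real N)\<^sup>2 > 0" using N by auto
  have num: "(real N)\<^sup>2 \<le> dual_factor N A x" "dual_factor N A x \<le> (real N)\<^sup>2 + real N" if "x \<in> A" for x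
  proof -
    have "card {y\<in>A. y > x} \<le> card {x+1..N-1}" using A by (intro card_mono) auto
    moreover have "x \<le> N - 1" using that A by auto
    ultimately have "x + card {y\<in>A. y > x} \<le> N - 1" by simp
    then have "real x + real (card {y\<in>A. y > x}) \<le> real N - 1" using N by linarith
    then show "(real N)\<^sup>2 \<le> dual_factor N A x" "dual_factor N A x \<le> (real N)\<^sup>2 + real N"
      by (simp_all add: dual_factor_def)
  qed
  let ?d = "\<lambda>i. 2 * (real N)\<^sup>2 + real N - 1 - real i"
  have den: "2 * (real N)\<^sup>2 \<le> ?d i" "?d i \<le> 2 * (real N)\<^sup>2 + real N" if "i \<in> {1..?n}" for i
    using that cardle N by auto
  have numl: "((real N)\<^sup>2) ^ ?n \<le> (\<Prod>x\<in>A. dual_factor N A x)"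
    using prod_mono[of A "\<lambda>_. (real N)\<^sup>2" "dual_factor N A"] num by simp
  have numu: "(\<Prod>x\<in>A. dual_factor N A x) \<le> ((real N)\<^sup>2 + real N) ^ ?n"
  proof -
    have "0 \<le> dual_factor N A x" if "x \<in> A" for x
      using num(1)[OF that] N0 by linarith
    then show ?thesis
      using prod_mono[of A "dual_factor N A" "\<lambda>_. (real N)\<^sup>2 + real N"] num by simp
  qed
  have denl: "(2 * (real N)\<^sup>2) ^ ?n \<le> (\<Prod>i=1..?n. ?d i)"
    using prod_mono[of "{1..?n}" "\<lambda>_. 2 * (real N)\<^sup>2" ?d] den by simp
  have denu: "(\<Prod>i=1..?n. ?d i) \<le> (2 * (real N)\<^sup>2 + real N) ^ ?n"
  proof -
    have "0 \<le> ?d i" if "i \<in> {1..?n}" for i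
      using den(1)[OF that] N0 by linarith
    then show ?thesis
      using prod_mono[of "{1..?n}" ?d "\<lambda>_. 2 * (real N)\<^sup>2 + real N"] den by simp
  qed
  have dp: "(\<Prod>i=1..?n. ?d i) > 0" using dual_solution_denom_pos[OF N cardle] .
  have "((1 - 1 / real N) / 2) ^ ?n \<le> ((real N)\<^sup>2 / (2 * (real N)\<^sup>2 + real N)) ^ ?n"
  proof (intro power_mono)
    have "0 \<le> 1 / real N" by simp
    moreover have "(1 - 1 / real N) / 2 * (2 * (real N)\<^sup>2 + real N) = (real N)\<^sup>2 - (real N + 1) / 2 + 1/2 - 1/2"
      using N0 by (simp add: field_simps power2_eq_square)
    ultimately show "(1 - 1 / real N) / 2 \<le> (real N)\<^sup>2 / (2 * (real N)\<^sup>2 + real N)"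
      using N0 by (simp add: pos_le_divide_eq add_pos_pos)
  qed (use N in auto)
  also have "\<dots> = ((real N)\<^sup>2) ^ ?n / (2 * (real N)\<^sup>2 + real N) ^ ?n" by (simp add: power_divide)
  also have "\<dots> \<le> dual_solution N A"
    unfolding dual_solution_def using numl denu dp
    by (intro frac_le order_trans[OF _ numl]) auto
  finally show "((1 - 1 / real N) / 2) ^ ?n \<le> dual_solution N A" .
  have "dual_solution N A \<le> ((real N)\<^sup>2 + real N) ^ ?n / (2 * (real N)\<^sup>2) ^ ?n"
    unfolding dual_solution_def using numu denl N0
    by (intro frac_le) auto
  also have "\<dots> = ((1 + 1 / real N) / 2) ^ ?n"
  proof -
    have "((real N)\<^sup>2 + real N) / (2 * (real N)\<^sup>2) = (1 + 1 / real N) / 2"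
      using N0 by (simp add: power2_eq_square field_simps)
    then show ?thesis by (metis power_divide)
  qed
  finally show "dual_solution N A \<le> ((1 + 1 / real N) / 2) ^ ?n" .
qed

section \<open>Left-right symmetry of the dual system\<close>

lemma reflect_sites:
  fixes N :: nat
  assumes A: "A \<subseteq> {1..N-1}"
  shows "(\<lambda>x. N - x) ` A \<subseteq> {1..N-1}"
    and "card ((\<lambda>x. N - x) ` A) = card A"
    and "(\<lambda>x. N - x) ` (\<lambda>x. N - x) ` A = A"
proof -
  have x: "1 \<le> x \<and> x < N" if "x \<in> A" for x
    using subsetD[OF A that] by auto
  show "(\<lambda>x. N - x) ` A \<subseteq> {1..N-1}"
  proof
    fix y assume "y \<in> (\<lambda>x. N - x) ` A"
    then obtain z where "z \<in> A" "y = N - z" by blast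
    then show "y \<in> {1..N-1}" using x[of z] by simp linarith
  qed
  have "inj_on (\<lambda>x. N - x) A"
  proof (rule inj_onI)
    fix y z assume "y \<in> A" "z \<in> A" "N - y = N - z"
    then show "y = z" using x[of y] x[of z] by linarith
  qed
  then show "card ((\<lambda>x. N - x) ` A) = card A" by (rule card_image)
  have "(\<lambda>x. N - (N - x)) ` A = (\<lambda>x. x) ` A"
    using x by (intro image_cong refl) (simp add: less_imp_le)
  then show "(\<lambda>x. N - x) ` (\<lambda>x. N - x) ` A = A" by (simp add: image_image)
qed

text \<open>The explicit solution has right absorption value 0; reflection makes it available when
  the left value is 0.\<close>

lemma dual_system_reflect:
  assumes N: "N \<ge> 3" and sys: "dual_system N a c \<phi>"
  shows "dual_system N c a (\<lambda>A. \<phi> ((\<lambda>x. N - x) ` A))"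
  unfolding dual_system_def
proof (intro allI impI)
  fix A assume A: "A \<subseteq> {1..N-1}"
  let ?r = "\<lambda>x. N - x"
  let ?B = "?r ` A"
  have B: "?B \<subseteq> {1..N-1}" by (rule reflect_sites(1)[OF A])
  have mem: "N - y \<in> ?B \<longleftrightarrow> y \<in> A" if "y \<in> {1..N-1}" for y
  proof -
    have "N - y \<in> ?B \<Longrightarrow> y \<in> A"
    proof -
      assume "N - y \<in> ?B"
      then obtain z where z: "z \<in> A" "N - y = N - z" by auto
      moreover from z A have "z \<in> {1..N-1}" by auto
      then have "z = y" using z(2) that by simp linarith
      ultimately show ?thesis by simp
    qed
    then show ?thesis by auto
  qed
  have diff: "?r ` (A - {y}) = ?B - {N - y}" if "y \<in> {1..N-1}" for y
  proof -
    have "inj_on ?r {1..N-1}" by (auto simp: inj_on_def)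
    then show ?thesis using A that inj_on_image_set_diff[of ?r "{1..N-1}" A "{y}"] by auto
  qed
  \<comment> \<open>The bond between x and x+1 is reflected to the bond between N-1-x and
    N-x.\<close>
  have tr: "?r ` (swap x (x+1) ` A) = swap (N-1-x) (N-1-x+1) ` ?B" if "x \<in> {1..N-2}" for x
    unfolding image_image
  proof (rule image_cong)
    fix y assume "y \<in> A"
    then have "y \<in> {1..N-1}" using A by auto
    then show "N - swap x (x+1) y = swap (N-1-x) (N-1-x+1) (N - y)"
      using that by (auto simp: Transposition.transpose_def)
  qed simp
  have "(\<Sum>x = 1..N-2. \<phi> (?r ` (swap x (x+1) ` A)) - \<phi> ?B)
     = (\<Sum>x = 1..N-2. \<phi> (swap (N-1-x) (N-1-x+1) ` ?B) - \<phi> ?B)"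
    using tr by (intro sum.cong) auto
  also have "\<dots> = (\<Sum>x = 1..N-2. \<phi> (swap x (x+1) ` ?B) - \<phi> ?B)"
    by (rule sum.reindex_bij_witness[of _ "\<lambda>x. N-1-x" "\<lambda>x. N-1-x"]) (use N in auto)
  finally have s: "(\<Sum>x = 1..N-2. \<phi> (?r ` (swap x (x+1) ` A)) - \<phi> ?B) = \<dots>" .
  have m1: "N - 1 \<in> ?B \<longleftrightarrow> 1 \<in> A" using mem[of 1] N by simp
  have m2: "1 \<in> ?B \<longleftrightarrow> N - 1 \<in> A" using mem[of "N-1"] N by simp
  have d1: "?r ` (A - {1}) = ?B - {N-1}" using diff[of 1] N by simp
  have d2: "?r ` (A - {N-1}) = ?B - {1}" using diff[of "N-1"] N by simp
  show "(real N)\<^sup>2 * (\<Sum>x = 1..N-2. \<phi> (?r ` (swap x (x+1) ` A)) - \<phi> ?B)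
      + (if 1 \<in> A then c * \<phi> (?r ` (A - {1})) - \<phi> ?B else 0)
      + (if N-1 \<in> A then a * \<phi> (?r ` (A - {N-1})) - \<phi> ?B else 0) = 0"
    using sys[unfolded dual_system_def, rule_format, OF B]
    unfolding s d1 d2 m1 m2 by linarith
qed

section \<open>Stationary correlations and the moment generating function\<close>

lemma finite_configs [simp]: "finite (configs N)"
  by (simp add: configs_def finite_PiE)

lemma configsD: "\<eta> \<in> configs N \<Longrightarrow> x \<in> {1..N-1} \<Longrightarrow> \<eta> x = 0 \<or> \<eta> x = 1"
  by (auto simp: configs_def PiE_iff)

lemma exchange_configs:
  assumes "\<eta> \<in> configs N" "x \<in> {1..N-1}" "y \<in> {1..N-1}"
  shows "exchange x y \<eta> \<in> configs N"
  using assms unfolding configs_def exchange_def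
  by (auto simp: PiE_iff extensional_def)

lemma flip_configs:
  assumes "\<eta> \<in> configs N" "x \<in> {1..N-1}"
  shows "flip x \<eta> \<in> configs N"
  using assms unfolding configs_def flip_def
  by (auto simp: PiE_iff extensional_def)

text \<open>Boundedness in the supremum norm dominates the exponential series. The constant counts
  at most N bonds with rate N^2 and two boundary sites, each with a difference of at most
  2K.\<close>

lemma gen_bound:
  assumes N: "N \<ge> 3" and K: "\<And>\<eta>. \<eta> \<in> configs N \<Longrightarrow> \<bar>f \<eta>\<bar> \<le> K"
    and ab: "0 \<le> \<alpha>" "\<alpha> \<le> 1" "0 \<le> \<beta>" "\<beta> \<le> 1" and \<eta>: "\<eta> \<in> configs N"
  shows "\<bar>gen \<alpha> \<beta> N f \<eta>\<bar> \<le> (2 * (real N)^3 + 4) * K"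
proof -
  have K0: "K \<ge> 0" using K[OF \<eta>] by linarith
  have "\<bar>gen_bulk N f \<eta>\<bar> \<le> (\<Sum>x=1..N-2. 2 * K)"
    unfolding gen_bulk_def
  proof (rule order_trans[OF sum_abs], rule sum_mono)
    fix x assume "x \<in> {1..N-2}"
    then have "exchange x (x+1) \<eta> \<in> configs N"
      using N by (intro exchange_configs[OF \<eta>]) auto
    then show "\<bar>f (exchange x (x+1) \<eta>) - f \<eta>\<bar> \<le> 2 * K"
      using K[of "exchange x (x+1) \<eta>"] K[OF \<eta>] by linarith
  qed
  also have "\<dots> \<le> real N * (2 * K)" using N K0 by (auto intro!: mult_right_mono)
  finally have "(real N)\<^sup>2 * \<bar>gen_bulk N f \<eta>\<bar> \<le> (real N)\<^sup>2 * (real N * (2 * K))"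
    by (intro mult_left_mono) auto
  also have "\<dots> = 2 * (real N)^3 * K" by (simp add: power2_eq_square power3_eq_cube)
  finally have 1: "\<bar>(real N)\<^sup>2 * gen_bulk N f \<eta>\<bar> \<le> 2 * (real N)^3 * K" by (simp add: abs_mult)
  have "\<bar>gen_boundary \<alpha> \<beta> N f \<eta>\<bar> \<le> (\<Sum>x\<in>{1, N-1}. 2 * K)"
    unfolding gen_boundary_def
  proof (rule order_trans[OF sum_abs], rule sum_mono)
    fix x assume x: "x \<in> {1, N-1}"
    then have x': "x \<in> {1..N-1}" using N by auto
    let ?r = "reservoir \<alpha> \<beta> x * (1 - real (\<eta> x)) + (1 - reservoir \<alpha> \<beta> x) * real (\<eta> x)"
    have "\<bar>?r\<bar> \<le> 1" using configsD[OF \<eta> x'] ab by (auto simp: reservoir_def)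
    moreover have "\<bar>f (flip x \<eta>) - f \<eta>\<bar> \<le> 2 * K"
      using K[OF flip_configs[OF \<eta> x']] K[OF \<eta>] by linarith
    ultimately have "\<bar>?r\<bar> * \<bar>f (flip x \<eta>) - f \<eta>\<bar> \<le> 1 * (2 * K)"
      by (intro mult_mono) auto
    then show "\<bar>?r * (f (flip x \<eta>) - f \<eta>)\<bar> \<le> 2 * K" by (simp add: abs_mult)
  qed
  also have "\<dots> \<le> 4 * K" using K0 by (cases "N - 1 = 1") auto
  finally have 2: "\<bar>gen_boundary \<alpha> \<beta> N f \<eta>\<bar> \<le> 4 * K" .
  show ?thesis unfolding gen_def using 1 2 by (simp add: algebra_simps)
qed

lemma expectation_configs:
  assumes "set_pmf \<mu> \<subseteq> configs N"
  shows "measure_pmf.expectation \<mu> f = (\<Sum>\<eta>\<in>configs N. f \<eta> * pmf \<mu> \<eta>)"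
  using assms by (intro integral_measure_pmf_real) auto

text \<open>Differentiating \<open>t \<mapsto> E(exp (t L) f)\<close>, which is constant, at \<open>t = 0\<close>.\<close>

lemma stationary_gen:
  assumes st: "stationary \<alpha> \<beta> N \<mu>" and N: "N \<ge> 3"
    and ab: "0 \<le> \<alpha>" "\<alpha> \<le> 1" "0 \<le> \<beta>" "\<beta> \<le> 1"
  shows "(\<Sum>\<eta>\<in>configs N. gen \<alpha> \<beta> N f \<eta> * pmf \<mu> \<eta>) = 0"
proof -
  have sub: "set_pmf \<mu> \<subseteq> configs N" using st by (simp add: stationary_def)
  define L where "L n = (gen \<alpha> \<beta> N ^^ n) f" for n
  define c where "c n = (\<Sum>\<eta>\<in>configs N. L n \<eta> * pmf \<mu> \<eta>)" for n
  define K where "K = (\<Sum>\<eta>\<in>configs N. \<bar>f \<eta>\<bar>)"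
  define C where "C = 2 * (real N)^3 + 4"
  have Lb: "\<bar>L n \<eta>\<bar> \<le> C ^ n * K" if "\<eta> \<in> configs N" for n \<eta>
    using that
  proof (induction n arbitrary: \<eta>)
    case 0
    have "\<bar>f \<eta>\<bar> \<le> (\<Sum>\<eta>\<in>configs N. \<bar>f \<eta>\<bar>)"
      by (rule member_le_sum) (use 0 in auto)
    then show ?case by (simp add: L_def K_def)
  next
    case (Suc n)
    have "\<bar>gen \<alpha> \<beta> N (L n) \<eta>\<bar> \<le> C * (C ^ n * K)"
      unfolding C_def by (rule gen_bound[OF N _ ab Suc.prems]) (rule Suc.IH[unfolded C_def])
    then show ?case by (simp add: L_def mult.assoc)
  qed
  have summ: "summable (\<lambda>n. t ^ n / fact n * L n \<eta>)" if "\<eta> \<in> configs N" for t \<eta>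
  proof (rule summable_comparison_test')
    show "summable (\<lambda>n. K * ((\<bar>t\<bar> * C) ^ n /\<^sub>R fact n))"
      using summable_exp_generic[of "\<bar>t\<bar> * C"] by (rule summable_mult)
    fix n :: nat
    have "\<bar>t ^ n / fact n\<bar> * \<bar>L n \<eta>\<bar> \<le> \<bar>t ^ n / fact n\<bar> * (C ^ n * K)"
      using Lb[OF that] by (intro mult_left_mono) auto
    also have "\<dots> = K * ((\<bar>t\<bar> * C) ^ n /\<^sub>R fact n)"
      by (simp add: power_mult_distrib power_abs abs_mult divide_inverse)
    finally show "norm (t ^ n / fact n * L n \<eta>) \<le> K * ((\<bar>t\<bar> * C) ^ n /\<^sub>R fact n)"
      by (simp add: abs_mult)
  qed
  have eq: "(\<Sum>n. c n / fact n * t ^ n) = measure_pmf.expectation \<mu> (semigroup_op \<alpha> \<beta> N t f)"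
    and sm: "summable (\<lambda>n. c n / fact n * t ^ n)" for t
  proof -
    have e: "c n / fact n * t ^ n = (\<Sum>\<eta>\<in>configs N. t ^ n / fact n * L n \<eta> * pmf \<mu> \<eta>)" for n
      unfolding c_def sum_distrib_right sum_divide_distrib by (intro sum.cong) auto
    show "summable (\<lambda>n. c n / fact n * t ^ n)"
      unfolding e using summ by (intro summable_sum summable_mult2) auto
    have "(\<Sum>n. c n / fact n * t ^ n) = (\<Sum>\<eta>\<in>configs N. \<Sum>n. t ^ n / fact n * L n \<eta> * pmf \<mu> \<eta>)"
      unfolding e using summ by (intro suminf_sum summable_mult2) auto
    also have "\<dots> = (\<Sum>\<eta>\<in>configs N. semigroup_op \<alpha> \<beta> N t f \<eta> * pmf \<mu> \<eta>)"
      unfolding semigroup_op_def L_def[symmetric] using summ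
      by (intro sum.cong suminf_mult2[symmetric]) auto
    finally show "(\<Sum>n. c n / fact n * t ^ n) = measure_pmf.expectation \<mu> (semigroup_op \<alpha> \<beta> N t f)"
      using sub by (simp add: expectation_configs)
  qed
  define g where "g t = (\<Sum>n. c n / fact n * t ^ n)" for t
  have const: "g t = g 0" if "t \<ge> 0" for t
    using st that unfolding g_def eq by (simp add: stationary_def)
  have "DERIV g 0 :> (\<Sum>n. diffs (\<lambda>n. c n / fact n) n * 0 ^ n)"
    unfolding g_def using termdiffs_strong[OF sm[of 1], of 0] by simp
  then have "DERIV g 0 :> c 1"
    unfolding powser_zero by (simp add: diffs_def)
  \<comment> \<open>\<open>stationary\<close> gives constancy for t \<ge> 0 only, so the derivative
    is read off from the right.\<close>
  then have "((\<lambda>h. (g h - g 0) / h) \<longlongrightarrow> c 1) (at_right 0)"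
    unfolding DERIV_def by (simp add: filterlim_at_split)
  moreover have "((\<lambda>h. (g h - g 0) / h) \<longlongrightarrow> 0) (at_right 0)"
  proof (rule tendsto_eventually)
    show "eventually (\<lambda>h. (g h - g 0) / h = 0) (at_right 0)"
      using eventually_at_right_less
    proof (rule eventually_mono)
      fix h :: real assume "0 < h"
      then have "g h = g 0" by (intro const) simp
      then show "(g h - g 0) / h = 0" by simp
    qed
  qed
  ultimately have "c 1 = 0"
    by (rule tendsto_unique[rotated]) simp
  then show ?thesis by (simp add: c_def L_def)
qed

section \<open>Correlations of the stationary measure\<close>

definition centered :: "real \<Rightarrow> nat set \<Rightarrow> (nat \<Rightarrow> nat) \<Rightarrow> real" where
  "centered b A \<eta> = (\<Prod>x\<in>A. real (\<eta> x) - b)"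

lemma centered_exchange: "centered b A (exchange x y \<eta>) = centered b (swap x y ` A) \<eta>"
proof -
  have "exchange x y \<eta> z = \<eta> (swap x y z)" for z
    by (cases "z = x"; cases "z = y") (simp_all add: exchange_def)
  then show ?thesis
    unfolding centered_def by (simp add: prod.reindex)
qed

text \<open>Flipping with this rate amounts to resampling the site from Bernoulli(r) at rate 1. This
  replaces the factor \<eta>(x) - b by its mean r - b, the absorption value of the dual
  particle.\<close>

lemma centered_flip:
  assumes "finite A" "\<eta> x = 0 \<or> \<eta> x = 1"
  shows "(r * (1 - real (\<eta> x)) + (1 - r) * real (\<eta> x)) * (centered b A (flip x \<eta>) - centered b A \<eta>)
    = (if x \<in> A then (r - b) * centered b (A - {x}) \<eta> - centered b A \<eta> else 0)"
proof (cases "x \<in> A")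
  case True
  have 1: "centered b A \<zeta> = (real (\<zeta> x) - b) * centered b (A - {x}) \<zeta>" for \<zeta>
    unfolding centered_def by (rule prod.remove[OF assms(1) True])
  have 2: "centered b (A - {x}) (flip x \<eta>) = centered b (A - {x}) \<eta>"
    unfolding centered_def by (intro prod.cong) (auto simp: flip_def)
  show ?thesis unfolding 1 2 using assms(2)
    by (elim disjE) (simp_all add: True flip_def algebra_simps)
next
  case False
  then have "centered b A (flip x \<eta>) = centered b A \<eta>"
    unfolding centered_def by (intro prod.cong) (auto simp: flip_def)
  with False show ?thesis by simp
qed

text \<open>The generator applied to a correlation function acts on the set A: exchanges transpose
  its sites and reservoirs delete one. Taking the stationary mean gives equations in the
  correlations alone.\<close>

lemma dual_system_moments:
  assumes st: "stationary \<alpha> \<beta> N \<mu>" and N: "N \<ge> 3"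
    and ab: "0 \<le> \<alpha>" "\<alpha> \<le> 1" "0 \<le> \<beta>" "\<beta> \<le> 1"
  shows "dual_system N (\<alpha> - b) (\<beta> - b) (\<lambda>A. measure_pmf.expectation \<mu> (centered b A))"
  unfolding dual_system_def
proof (intro allI impI)
  fix A assume A: "A \<subseteq> {1..N-1}"
  then have fin: "finite A" using finite_subset by blast
  have sub: "set_pmf \<mu> \<subseteq> configs N" using st by (simp add: stationary_def)
  let ?E = "\<lambda>A. measure_pmf.expectation \<mu> (centered b A)"
  have E: "?E B = (\<Sum>\<eta>\<in>configs N. centered b B \<eta> * pmf \<mu> \<eta>)" for B
    by (rule expectation_configs[OF sub])
  have g: "gen \<alpha> \<beta> N (centered b A) \<eta>
     = (real N)\<^sup>2 * (\<Sum>x = 1..N-2. centered b (swap x (x+1) ` A) \<eta> - centered b A \<eta>)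
     + (if 1 \<in> A then (\<alpha> - b) * centered b (A - {1}) \<eta> - centered b A \<eta> else 0)
     + (if N-1 \<in> A then (\<beta> - b) * centered b (A - {N-1}) \<eta> - centered b A \<eta> else 0)"
    if \<eta>: "\<eta> \<in> configs N" for \<eta>
  proof -
    have "gen_boundary \<alpha> \<beta> N (centered b A) \<eta> =
      (\<Sum>x\<in>{1, N-1}. if x \<in> A then (reservoir \<alpha> \<beta> x - b) * centered b (A - {x}) \<eta> - centered b A \<eta> else 0)"
      unfolding gen_boundary_def
    proof (rule sum.cong)
      fix x assume "x \<in> {1, N-1}"
      then have "x \<in> {1..N-1}" using N by auto
      then have "\<eta> x = 0 \<or> \<eta> x = 1" by (rule configsD[OF \<eta>])
      then show "(reservoir \<alpha> \<beta> x * (1 - real (\<eta> x)) + (1 - reservoir \<alpha> \<beta> x) * real (\<eta> x))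
          * (centered b A (flip x \<eta>) - centered b A \<eta>)
        = (if x \<in> A then (reservoir \<alpha> \<beta> x - b) * centered b (A - {x}) \<eta> - centered b A \<eta> else 0)"
        by (rule centered_flip[OF fin])
    qed simp
    moreover have "N - 1 \<noteq> 1" using N by simp
    ultimately show ?thesis
      unfolding gen_def gen_bulk_def centered_exchange by (simp add: reservoir_def)
  qed
  have "(\<Sum>\<eta>\<in>configs N. gen \<alpha> \<beta> N (centered b A) \<eta> * pmf \<mu> \<eta>) =
    (\<Sum>\<eta>\<in>configs N. ((real N)\<^sup>2 * (\<Sum>x = 1..N-2. centered b (swap x (x+1) ` A) \<eta> - centered b A \<eta>)
     + (if 1 \<in> A then (\<alpha> - b) * centered b (A - {1}) \<eta> - centered b A \<eta> else 0)
     + (if N-1 \<in> A then (\<beta> - b) * centered b (A - {N-1}) \<eta> - centered b A \<eta> else 0)) * pmf \<mu> \<eta>)"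
    using g by (intro sum.cong) auto
  also have "\<dots> = (real N)\<^sup>2 * (\<Sum>\<eta>\<in>configs N. (\<Sum>x = 1..N-2. centered b (swap x (x+1) ` A) \<eta> - centered b A \<eta>) * pmf \<mu> \<eta>)
     + (if 1 \<in> A then (\<alpha> - b) * ?E (A - {1}) - ?E A else 0)
     + (if N-1 \<in> A then (\<beta> - b) * ?E (A - {N-1}) - ?E A else 0)"
  proof -
    have "(\<Sum>\<eta>\<in>configs N. ((real N)\<^sup>2 * h \<eta> + u \<eta> + v \<eta>) * pmf \<mu> \<eta>) =
      (real N)\<^sup>2 * (\<Sum>\<eta>\<in>configs N. h \<eta> * pmf \<mu> \<eta>)
      + (\<Sum>\<eta>\<in>configs N. u \<eta> * pmf \<mu> \<eta>) + (\<Sum>\<eta>\<in>configs N. v \<eta> * pmf \<mu> \<eta>)" for h u v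
      by (simp add: distrib_right sum.distrib sum_distrib_left mult.assoc)
    moreover have "(\<Sum>\<eta>\<in>configs N. (if P then a * centered b B \<eta> - centered b A \<eta> else 0) * pmf \<mu> \<eta>)
      = (if P then a * ?E B - ?E A else 0)" for P a B
      unfolding E by (cases P) (simp_all add: left_diff_distrib sum_subtractf sum_distrib_left mult.assoc)
    ultimately show ?thesis by simp
  qed
  also have "(\<Sum>\<eta>\<in>configs N. (\<Sum>x = 1..N-2. centered b (swap x (x+1) ` A) \<eta> - centered b A \<eta>) * pmf \<mu> \<eta>)
     = (\<Sum>x = 1..N-2. ?E (swap x (x+1) ` A) - ?E A)"
    unfolding E sum_distrib_right
    by (subst sum.swap) (simp only: left_diff_distrib sum_subtractf)
  finally show "(real N)\<^sup>2 * (\<Sum>x = 1..N-2. ?E (swap x (x+1) ` A) - ?E A)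
     + (if 1 \<in> A then (\<alpha> - b) * ?E (A - {1}) - ?E A else 0)
     + (if N-1 \<in> A then (\<beta> - b) * ?E (A - {N-1}) - ?E A else 0) = 0"
    using stationary_gen[OF st N ab, of "centered b A"] by simp
qed

lemma moments_right:
  assumes st: "stationary \<alpha> \<beta> N \<mu>" and N: "N \<ge> 3"
    and ab: "0 \<le> \<alpha>" "\<alpha> \<le> 1" "0 \<le> \<beta>" "\<beta> \<le> 1" and A: "A \<subseteq> {1..N-1}"
  shows "measure_pmf.expectation \<mu> (centered \<beta> A) = (\<alpha> - \<beta>) ^ card A * dual_solution N A"
proof (rule dual_system_unique[OF N _ dual_system_solution[OF N] _ A])
  show "dual_system N (\<alpha> - \<beta>) 0 (\<lambda>A. measure_pmf.expectation \<mu> (centered \<beta> A))"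
    using dual_system_moments[OF st N ab, of \<beta>] by simp
qed (simp add: centered_def dual_solution_def)

text \<open>Centring at \<alpha> makes the left absorption value zero; reflection moves the zero to
  the right, where the explicit solution applies.\<close>

lemma moments_left:
  assumes st: "stationary \<alpha> \<beta> N \<mu>" and N: "N \<ge> 3"
    and ab: "0 \<le> \<alpha>" "\<alpha> \<le> 1" "0 \<le> \<beta>" "\<beta> \<le> 1" and A: "A \<subseteq> {1..N-1}"
  shows "measure_pmf.expectation \<mu> (centered \<alpha> A)
    = (\<beta> - \<alpha>) ^ card A * dual_solution N ((\<lambda>x. N - x) ` A)"
proof -
  let ?r = "\<lambda>x. N - x"
  note sub = reflect_sites(1)[OF A] and c = reflect_sites(2)[OF A] and rr = reflect_sites(3)[OF A]
  have "measure_pmf.expectation \<mu> (centered \<alpha> (?r ` ?r ` A)) = (\<beta> - \<alpha>) ^ card (?r ` A) * dual_solution N (?r ` A)"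
  proof (rule dual_system_unique[OF N _ dual_system_solution[OF N] _ sub])
    show "dual_system N (\<beta> - \<alpha>) 0 (\<lambda>A. measure_pmf.expectation \<mu> (centered \<alpha> (?r ` A)))"
      using dual_system_reflect[OF N dual_system_moments[OF st N ab, of \<alpha>]] by simp
  qed (simp add: centered_def dual_solution_def)
  then show ?thesis by (simp only: rr c)
qed

text \<open>Every correlation of \<open>\<eta> - \<beta>\<close> carries the sign of \<open>(\<alpha> - \<beta>) ^ card A\<close>, and with the
  two reservoirs interchanged for \<open>\<eta> - \<alpha>\<close>; centring at the reservoir for which all terms
  below are nonnegative gives two-sided bounds for every tilt.\<close>

lemma mgf_bounds_of_sign:
  fixes \<mu> :: "(nat \<Rightarrow> nat) pmf"
  assumes N: "N \<ge> 3" and sub: "set_pmf \<mu> \<subseteq> configs N"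
    and mom: "\<And>A. A \<subseteq> {1..N-1} \<Longrightarrow> \<exists>q. measure_pmf.expectation \<mu> (centered b A) = (b' - b) ^ card A * q
       \<and> ((1 - 1 / real N) / 2) ^ card A \<le> q \<and> q \<le> ((1 + 1 / real N) / 2) ^ card A"
    and b: "0 < b" "b < 1" "0 < b'" "b' < 1" and sign: "0 \<le> \<theta> * (b' - b)"
  defines "\<gamma> \<equiv> (b + b') / 2" and "Z \<equiv> measure_pmf.expectation \<mu> (\<lambda>\<eta>. exp (\<theta> * (\<Sum>x=1..N-1. real (\<eta> x))))"
  shows "((1 - \<gamma> + \<gamma> * exp \<theta>) * (1 - 1 / real N)) ^ (N-1) \<le> Z"
    and "Z \<le> ((1 - \<gamma> + \<gamma> * exp \<theta>) * (1 + 1 / real N)) ^ (N-1)"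
proof -
  \<comment> \<open>Chosen so that exp (\<theta> y) = D (1 + s (y - b)) for y = 0 and y = 1; D is
    the Bernoulli(b) moment generating function. k is the weight per site once the correlations are
    inserted, and correlations with q = 2^(-n) would give 1 + k/2 per site.\<close>
  define D where "D = 1 - b + b * exp \<theta>"
  define s where "s = (exp \<theta> - 1) / D"
  define k where "k = s * (b' - b)"
  have D: "D > 0" using b by (simp add: D_def add_pos_pos)
  have M: "D * (1 + k / 2) = 1 - \<gamma> + \<gamma> * exp \<theta>"
    using D unfolding k_def s_def by (simp add: field_simps) (simp add: D_def \<gamma>_def field_simps)
  \<comment> \<open>exp \<theta> - 1 has the sign of \<theta>; with k \<ge> 0 no two terms of the
    expansion cancel.\<close>
  have "0 \<le> (exp \<theta> - 1) * (b' - b)"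
    using sign by (auto simp: zero_le_mult_iff)
  then have k0: "k \<ge> 0" using D by (simp add: k_def s_def)
  let ?S = "{1..N-1}"
  have e1: "exp (\<theta> * (\<Sum>x=1..N-1. real (\<eta> x))) = D ^ (N-1) * (\<Sum>A\<in>Pow ?S. s ^ card A * centered b A \<eta>)"
    if \<eta>: "\<eta> \<in> configs N" for \<eta>
  proof -
    have "exp (\<theta> * (\<Sum>x=1..N-1. real (\<eta> x))) = (\<Prod>x\<in>?S. exp (\<theta> * real (\<eta> x)))"
      by (simp add: sum_distrib_left exp_sum)
    also have "\<dots> = (\<Prod>x\<in>?S. D * (s * (real (\<eta> x) - b) + 1))"
    proof (rule prod.cong)
      fix x assume "x \<in> ?S"
      then have "\<eta> x = 0 \<or> \<eta> x = 1" using configsD[OF \<eta>] by blast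
      moreover have Ds: "D * (s * y + 1) = (exp \<theta> - 1) * y + D" for y
        using D by (simp add: s_def field_simps)
      ultimately show "exp (\<theta> * real (\<eta> x)) = D * (s * (real (\<eta> x) - b) + 1)"
        unfolding Ds by (auto simp: D_def algebra_simps)
    qed simp
    also have "\<dots> = D ^ (N-1) * (\<Prod>x\<in>?S. s * (real (\<eta> x) - b) + 1)"
      by (simp add: prod.distrib)
    also have "(\<Prod>x\<in>?S. s * (real (\<eta> x) - b) + 1) = (\<Sum>A\<in>Pow ?S. s ^ card A * centered b A \<eta>)"
      by (subst prod_add) (auto simp: centered_def prod.distrib)
    finally show ?thesis .
  qed
  have Z: "Z = D ^ (N-1) * (\<Sum>A\<in>Pow ?S. s ^ card A * measure_pmf.expectation \<mu> (centered b A))"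
  proof -
    have "Z = (\<Sum>\<eta>\<in>configs N. D ^ (N-1) * (\<Sum>A\<in>Pow ?S. s ^ card A * centered b A \<eta>) * pmf \<mu> \<eta>)"
      unfolding Z_def expectation_configs[OF sub] using e1 by (intro sum.cong) auto
    also have "\<dots> = D ^ (N-1) * (\<Sum>\<eta>\<in>configs N. \<Sum>A\<in>Pow ?S. s ^ card A * (centered b A \<eta> * pmf \<mu> \<eta>))"
      by (simp add: sum_distrib_left sum_distrib_right mult.assoc)
    finally show ?thesis
      unfolding expectation_configs[OF sub] by (subst (asm) sum.swap) (simp add: sum_distrib_left)
  qed
  have pw: "(\<Sum>A\<in>Pow ?S. z ^ card A) = (1 + z) ^ (N-1)" for z :: real
    using prod_add[of ?S "\<lambda>_. z" "\<lambda>_. 1"] by (simp add: add.commute)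
  have t: "k ^ card A * ((1 - 1 / real N) / 2) ^ card A \<le> s ^ card A * measure_pmf.expectation \<mu> (centered b A)
      \<and> s ^ card A * measure_pmf.expectation \<mu> (centered b A) \<le> k ^ card A * ((1 + 1 / real N) / 2) ^ card A"
    if AS: "A \<in> Pow ?S" for A
  proof -
    obtain q where q: "measure_pmf.expectation \<mu> (centered b A) = (b' - b) ^ card A * q"
       "((1 - 1 / real N) / 2) ^ card A \<le> q" "q \<le> ((1 + 1 / real N) / 2) ^ card A"
      using mom[OF PowD[OF AS]] by blast
    have "s ^ card A * measure_pmf.expectation \<mu> (centered b A) = k ^ card A * q"
      by (simp add: q k_def power_mult_distrib)
    then show ?thesis using q(2,3) k0 by (metis mult_left_mono zero_le_power)
  qed
  have "((1 - \<gamma> + \<gamma> * exp \<theta>) * (1 - 1 / real N)) ^ (N-1) = D ^ (N-1) * ((1 + k / 2) * (1 - 1 / real N)) ^ (N-1)"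
    by (simp flip: M add: power_mult_distrib)
  also have "\<dots> \<le> D ^ (N-1) * (1 + k * ((1 - 1 / real N) / 2)) ^ (N-1)"
  proof (intro mult_left_mono power_mono)
    \<comment> \<open>The correction affects k only; applying it to the whole bracket costs 1/N and
      lets the Bernoulli(\<gamma>) value factor out.\<close>
    have "(1 + k / 2) * (1 - 1 / real N) = 1 + k * ((1 - 1 / real N) / 2) - 1 / real N"
      by algebra
    then show "(1 + k / 2) * (1 - 1 / real N) \<le> 1 + k * ((1 - 1 / real N) / 2)" by simp
  qed (use D k0 N in auto)
  also have "\<dots> \<le> Z"
    unfolding Z pw[symmetric] power_mult_distrib using t D by (intro mult_left_mono sum_mono) auto
  finally show "((1 - \<gamma> + \<gamma> * exp \<theta>) * (1 - 1 / real N)) ^ (N-1) \<le> Z" .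
  have "Z \<le> D ^ (N-1) * (1 + k * ((1 + 1 / real N) / 2)) ^ (N-1)"
    unfolding Z pw[symmetric] power_mult_distrib using t D by (intro mult_left_mono sum_mono) auto
  also have "\<dots> \<le> D ^ (N-1) * ((1 + k / 2) * (1 + 1 / real N)) ^ (N-1)"
  proof (intro mult_left_mono power_mono)
    have "(1 + k / 2) * (1 + 1 / real N) = 1 + k * ((1 + 1 / real N) / 2) + 1 / real N"
      by algebra
    then show "1 + k * ((1 + 1 / real N) / 2) \<le> (1 + k / 2) * (1 + 1 / real N)" by simp
  qed (use D k0 N in auto)
  also have "\<dots> = ((1 - \<gamma> + \<gamma> * exp \<theta>) * (1 + 1 / real N)) ^ (N-1)"
    by (simp flip: M add: power_mult_distrib)
  finally show "Z \<le> ((1 - \<gamma> + \<gamma> * exp \<theta>) * (1 + 1 / real N)) ^ (N-1)" .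
qed

lemma mgf_bounds:
  fixes \<theta> :: real
  assumes st: "stationary \<alpha> \<beta> N \<mu>" and N: "N \<ge> 3"
    and ab: "0 < \<alpha>" "\<alpha> < 1" "0 < \<beta>" "\<beta> < 1"
  defines "\<gamma> \<equiv> (\<alpha> + \<beta>) / 2"
    and "Z \<equiv> measure_pmf.expectation \<mu> (\<lambda>\<eta>. exp (\<theta> * (\<Sum>x=1..N-1. real (\<eta> x))))"
  shows "((1 - \<gamma> + \<gamma> * exp \<theta>) * (1 - 1 / real N)) ^ (N-1) \<le> Z"
    and "Z \<le> ((1 - \<gamma> + \<gamma> * exp \<theta>) * (1 + 1 / real N)) ^ (N-1)"
proof -
  have ab': "0 \<le> \<alpha>" "\<alpha> \<le> 1" "0 \<le> \<beta>" "\<beta> \<le> 1" using ab by auto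
  have sub: "set_pmf \<mu> \<subseteq> configs N" using st by (simp add: stationary_def)
  have R: "\<exists>q. measure_pmf.expectation \<mu> (centered \<beta> A) = (\<alpha> - \<beta>) ^ card A * q
       \<and> ((1 - 1 / real N) / 2) ^ card A \<le> q \<and> q \<le> ((1 + 1 / real N) / 2) ^ card A"
    if "A \<subseteq> {1..N-1}" for A
    using moments_right[OF st N ab' that] dual_solution_bounds[OF N that] by blast
  have L: "\<exists>q. measure_pmf.expectation \<mu> (centered \<alpha> A) = (\<beta> - \<alpha>) ^ card A * q
       \<and> ((1 - 1 / real N) / 2) ^ card A \<le> q \<and> q \<le> ((1 + 1 / real N) / 2) ^ card A"
    if A: "A \<subseteq> {1..N-1}" for A
  proof -
    show ?thesis
      using moments_left[OF st N ab' that] dual_solution_bounds[OF N reflect_sites(1)[OF A]]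
      unfolding reflect_sites(2)[OF A] by blast
  qed
  have c: "\<gamma> = (\<beta> + \<alpha>) / 2" by (simp add: \<gamma>_def)
  consider "0 \<le> \<theta> * (\<alpha> - \<beta>)" | "0 \<le> \<theta> * (\<beta> - \<alpha>)"
    by (metis linear minus_diff_eq mult_minus_right neg_0_le_iff_le)
  then have "((1 - \<gamma> + \<gamma> * exp \<theta>) * (1 - 1 / real N)) ^ (N-1) \<le> Z \<and>
    Z \<le> ((1 - \<gamma> + \<gamma> * exp \<theta>) * (1 + 1 / real N)) ^ (N-1)"
  proof cases
    case 1
    show ?thesis using mgf_bounds_of_sign[OF N sub R ab(3,4,1,2) 1] unfolding Z_def c by blast
  next
    case 2
    show ?thesis using mgf_bounds_of_sign[OF N sub L ab 2] unfolding Z_def \<gamma>_def by blast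
  qed
  then show "((1 - \<gamma> + \<gamma> * exp \<theta>) * (1 - 1 / real N)) ^ (N-1) \<le> Z"
    and "Z \<le> ((1 - \<gamma> + \<gamma> * exp \<theta>) * (1 + 1 / real N)) ^ (N-1)" by blast+
qed

section \<open>Large deviations\<close>

text \<open>Convergence of the scaled cumulant functions to \<Lambda>, written without logarithms.
  Eventual finiteness of the support makes all integrands integrable.\<close>

definition has_log_mgf :: "(nat \<Rightarrow> 'a pmf) \<Rightarrow> (nat \<Rightarrow> 'a \<Rightarrow> real) \<Rightarrow> (real \<Rightarrow> real) \<Rightarrow> bool" where
  "has_log_mgf M X \<Lambda> \<longleftrightarrow> (\<forall>\<^sub>F N in sequentially. finite (set_pmf (M N))) \<and>
     (\<forall>\<theta>. \<forall>e>0. \<forall>\<^sub>F N in sequentially.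
        exp (real N * (\<Lambda> \<theta> - e)) \<le> measure_pmf.expectation (M N) (\<lambda>x. exp (real N * (\<theta> * X N x))) \<and>
        measure_pmf.expectation (M N) (\<lambda>x. exp (real N * (\<theta> * X N x))) \<le> exp (real N * (\<Lambda> \<theta> + e)))"

lemma log_mgf_finite:
  "has_log_mgf M X \<Lambda> \<Longrightarrow> \<forall>\<^sub>F N in sequentially. finite (set_pmf (M N))"
  by (simp add: has_log_mgf_def)

lemma log_mgf_bounds:
  assumes "has_log_mgf M X \<Lambda>" "e > 0"
  shows "\<forall>\<^sub>F N in sequentially.
    exp (real N * (\<Lambda> \<theta> - e)) \<le> measure_pmf.expectation (M N) (\<lambda>x. exp (real N * (\<theta> * X N x))) \<and>
    measure_pmf.expectation (M N) (\<lambda>x. exp (real N * (\<theta> * X N x))) \<le> exp (real N * (\<Lambda> \<theta> + e))"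
  using assms by (simp add: has_log_mgf_def)

text \<open>The exponential Markov inequality. Keeping \<theta> on both sides of the event covers
  the right tail for \<theta> > 0 and the left tail for \<theta> < 0.\<close>

lemma chernoff_upper:
  assumes mgf: "has_log_mgf M X \<Lambda>" and c: "c < \<theta> * m - \<Lambda> \<theta>"
  shows "\<forall>\<^sub>F N in sequentially. measure_pmf.prob (M N) {x. \<theta> * m \<le> \<theta> * X N x} \<le> exp (- real N * c)"
proof -
  define e where "e = \<theta> * m - \<Lambda> \<theta> - c"
  have "e > 0" using c by (simp add: e_def)
  from log_mgf_finite[OF mgf] log_mgf_bounds[OF mgf this, of \<theta>] show ?thesis
  proof eventually_elim
    case (elim N)
    let ?S = "{x. \<theta> * m \<le> \<theta> * X N x}"
    have "measure_pmf.prob (M N) ?S = measure_pmf.expectation (M N) (indicat_real ?S)" by simp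
    also have "\<dots> \<le> measure_pmf.expectation (M N) (\<lambda>x. exp (- (real N * (\<theta> * m))) * exp (real N * (\<theta> * X N x)))"
    proof (rule integral_mono)
      fix x
      show "indicat_real ?S x \<le> exp (- (real N * (\<theta> * m))) * exp (real N * (\<theta> * X N x))"
        by (auto simp: indicator_def mult_left_mono simp flip: exp_add)
    qed (use elim(1) in \<open>auto intro: integrable_measure_pmf_finite\<close>)
    also have "\<dots> = exp (- (real N * (\<theta> * m))) * measure_pmf.expectation (M N) (\<lambda>x. exp (real N * (\<theta> * X N x)))"
      by simp
    also have "\<dots> \<le> exp (- (real N * (\<theta> * m))) * exp (real N * (\<Lambda> \<theta> + e))"
      using elim(2) by (intro mult_left_mono) auto
    also have "\<dots> = exp (- real N * c)"
      unfolding exp_add[symmetric] e_def by (simp add: algebra_simps)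
    finally show ?case .
  qed
qed

text \<open>Under the measure tilted by \<open>\<theta>\<close> the variable concentrates at \<open>m = \<Lambda>' \<theta>\<close>: the moment
  generating functions at \<open>\<theta> + h\<close> and \<open>\<theta> - k\<close> control the two tails.\<close>

lemma tilting_lower:
  assumes mgf: "has_log_mgf M X \<Lambda>" and D: "(\<Lambda> has_real_derivative m) (at \<theta>)"
    and \<delta>: "\<delta> > 0" and e: "e > 0"
  shows "\<forall>\<^sub>F N in sequentially. exp (real N * (\<Lambda> \<theta> - \<theta> * m - \<bar>\<theta>\<bar> * \<delta> - e))
    \<le> measure_pmf.prob (M N) {x. \<bar>X N x - m\<bar> < \<delta>}"
proof -
  have D0: "((\<lambda>h. \<Lambda> (h + \<theta>) - h * b) has_real_derivative m - b) (at 0)" for b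
  proof -
    have "((\<lambda>h. \<Lambda> (h + \<theta>)) has_real_derivative m) (at 0)"
      using DERIV_shift[of \<Lambda> m 0 \<theta>] D by simp
    moreover have "((\<lambda>h::real. h * b) has_real_derivative b) (at 0)"
      by (auto intro!: derivative_eq_intros)
    ultimately show ?thesis by (rule DERIV_diff)
  qed
  \<comment> \<open>Subtracting a line of slope m + \<delta> makes the derivative at 0 equal to
    -\<delta>, so a small h gives the right tail strictly smaller exponential order. The slope m -
    \<delta> and k do the same on the left.\<close>
  obtain d where d: "d > 0" "\<And>h. 0 < h \<Longrightarrow> h < d \<Longrightarrow>
      \<Lambda> (0 + h + \<theta>) - (0 + h) * (m + \<delta>) < \<Lambda> (0 + \<theta>) - 0 * (m + \<delta>)"
    using DERIV_neg_dec_right[OF D0[of "m + \<delta>"]] \<delta> by auto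
  define h where "h = d / 2"
  have h: "h > 0" "\<Lambda> (\<theta> + h) - h * (m + \<delta>) < \<Lambda> \<theta>"
    using d(1) d(2)[of h] by (simp_all add: h_def add.commute)
  obtain d' where d': "d' > 0" "\<And>h. 0 < h \<Longrightarrow> h < d' \<Longrightarrow>
      \<Lambda> (0 - h + \<theta>) - (0 - h) * (m - \<delta>) < \<Lambda> (0 + \<theta>) - 0 * (m - \<delta>)"
    using DERIV_pos_inc_left[OF D0[of "m - \<delta>"]] \<delta> by auto
  define k where "k = d' / 2"
  have k: "k > 0" "\<Lambda> (\<theta> - k) + k * (m - \<delta>) < \<Lambda> \<theta>"
    using d'(1) d'(2)[of k] by (simp_all add: k_def)
  \<comment> \<open>Of the slack 4r in each tail one r is spent on the moment generating function.
    With y = exp (-N r) the full mass is at least L y and each tail at most L y^3.\<close>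
  define r where "r = min e (min (\<Lambda> \<theta> - (\<Lambda> (\<theta> + h) - h * (m + \<delta>))) (\<Lambda> \<theta> - (\<Lambda> (\<theta> - k) + k * (m - \<delta>)))) / 4"
  have r: "r > 0" using h k e by (simp add: r_def)
  have r4: "4 * r \<le> e" "4 * r \<le> \<Lambda> \<theta> - (\<Lambda> (\<theta> + h) - h * (m + \<delta>))" "4 * r \<le> \<Lambda> \<theta> - (\<Lambda> (\<theta> - k) + k * (m - \<delta>))"
    by (simp_all add: r_def)
  have "(\<lambda>N. exp (- (real N * r))) \<longlonglongrightarrow> 0" using r by real_asymp
  then have "\<forall>\<^sub>F N in sequentially. exp (- (real N * r)) < 1/2" by (rule order_tendstoD) simp
  from this log_mgf_finite[OF mgf] log_mgf_bounds[OF mgf r, of \<theta>]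
    log_mgf_bounds[OF mgf r, of "\<theta> + h"] log_mgf_bounds[OF mgf r, of "\<theta> - k"]
  show ?thesis
  proof eventually_elim
    case (elim N)
    let ?E = "measure_pmf.expectation (M N)"
    let ?Z = "\<lambda>t. ?E (\<lambda>x. exp (real N * (t * X N x)))"
    let ?S = "{x. \<bar>X N x - m\<bar> < \<delta>}"
    define y where "y = exp (- (real N * r))"
    have y3: "y ^ 3 = exp (- (3 * (real N * r)))"
      by (simp add: y_def power3_eq_cube flip: exp_add)
    define L where "L = exp (real N * \<Lambda> \<theta>)"
    have int: "integrable (measure_pmf (M N)) f" for f :: "'a \<Rightarrow> real"
      using elim(2) by (rule integrable_measure_pmf_finite)
    have "exp (real N * (\<theta> * x)) \<le> exp (real N * (\<theta> * m + \<bar>\<theta>\<bar> * \<delta>)) * of_bool (\<bar>x - m\<bar> < \<delta>)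
        + exp (- (real N * (h * (m + \<delta>)))) * exp (real N * ((\<theta> + h) * x))
        + exp (real N * (k * (m - \<delta>))) * exp (real N * ((\<theta> - k) * x))" for x
    proof -
      consider "\<bar>x - m\<bar> < \<delta>" | "x \<ge> m + \<delta>" | "x \<le> m - \<delta>" by linarith
      then show ?thesis
      proof cases
        case 1
        have "\<theta> * (x - m) \<le> \<bar>\<theta>\<bar> * \<bar>x - m\<bar>" by (metis abs_ge_self abs_mult)
        also have "\<dots> \<le> \<bar>\<theta>\<bar> * \<delta>" using 1 by (intro mult_left_mono) auto
        finally have "real N * (\<theta> * x) \<le> real N * (\<theta> * m + \<bar>\<theta>\<bar> * \<delta>)"
          by (intro mult_left_mono) (auto simp: algebra_simps)
        then show ?thesis using 1 by (simp add: add_increasing2)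
      next
        case 2
        then have "h * (m + \<delta>) \<le> h * x" using h by (intro mult_left_mono) auto
        then have "real N * (\<theta> * x) \<le> real N * (\<theta> * x + (h * x - h * (m + \<delta>)))"
          by (intro mult_left_mono) auto
        also have "\<dots> = - (real N * (h * (m + \<delta>))) + real N * ((\<theta> + h) * x)" by (simp add: algebra_simps)
        finally have "exp (real N * (\<theta> * x)) \<le> exp (- (real N * (h * (m + \<delta>)))) * exp (real N * ((\<theta> + h) * x))"
          by (simp flip: exp_add)
        then show ?thesis by (intro add_increasing2 add_increasing) auto
      next
        case 3
        then have "k * x \<le> k * (m - \<delta>)" using k by (intro mult_left_mono) auto
        then have "real N * (\<theta> * x) \<le> real N * (\<theta> * x + (k * (m - \<delta>) - k * x))"
          by (intro mult_left_mono) auto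
        also have "\<dots> = real N * (k * (m - \<delta>)) + real N * ((\<theta> - k) * x)" by (simp add: algebra_simps)
        finally have "exp (real N * (\<theta> * x)) \<le> exp (real N * (k * (m - \<delta>))) * exp (real N * ((\<theta> - k) * x))"
          by (simp flip: exp_add)
        then show ?thesis by (intro add_increasing) auto
      qed
    qed
    then have "?Z \<theta> \<le> ?E (\<lambda>x. exp (real N * (\<theta> * m + \<bar>\<theta>\<bar> * \<delta>)) * indicat_real ?S x
        + exp (- (real N * (h * (m + \<delta>)))) * exp (real N * ((\<theta> + h) * X N x))
        + exp (real N * (k * (m - \<delta>))) * exp (real N * ((\<theta> - k) * X N x)))"
      by (intro integral_mono int) (simp add: indicator_def)
    also have "\<dots> = exp (real N * (\<theta> * m + \<bar>\<theta>\<bar> * \<delta>)) * measure_pmf.prob (M N) ?S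
        + exp (- (real N * (h * (m + \<delta>)))) * ?Z (\<theta> + h)
        + exp (real N * (k * (m - \<delta>))) * ?Z (\<theta> - k)"
      by (simp add: int)
    finally have Z: "?Z \<theta> \<le> \<dots>" .
    have 1: "L * y \<le> ?Z \<theta>"
      using elim(3) by (simp add: L_def y_def right_diff_distrib flip: exp_add)
    have "exp (- (real N * (h * (m + \<delta>)))) * ?Z (\<theta> + h)
        \<le> exp (- (real N * (h * (m + \<delta>)))) * exp (real N * (\<Lambda> (\<theta> + h) + r))"
      using elim(4) by (intro mult_left_mono) auto
    also have "\<dots> = exp (real N * (\<Lambda> (\<theta> + h) + r - h * (m + \<delta>)))"
      by (simp add: algebra_simps flip: exp_add)
    also have "\<dots> \<le> exp (real N * (\<Lambda> \<theta> - 3 * r))"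
      using r4(2) by (intro exp_le_cancel_iff[THEN iffD2] mult_left_mono) auto
    also have "\<dots> = L * y ^ 3"
      unfolding L_def y3 exp_add[symmetric] by (simp add: algebra_simps)
    finally have 2: "exp (- (real N * (h * (m + \<delta>)))) * ?Z (\<theta> + h) \<le> L * y ^ 3" .
    have "exp (real N * (k * (m - \<delta>))) * ?Z (\<theta> - k)
        \<le> exp (real N * (k * (m - \<delta>))) * exp (real N * (\<Lambda> (\<theta> - k) + r))"
      using elim(5) by (intro mult_left_mono) auto
    also have "\<dots> = exp (real N * (\<Lambda> (\<theta> - k) + r + k * (m - \<delta>)))"
      by (simp add: algebra_simps flip: exp_add)
    also have "\<dots> \<le> exp (real N * (\<Lambda> \<theta> - 3 * r))"
      using r4(3) by (intro exp_le_cancel_iff[THEN iffD2] mult_left_mono) auto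
    also have "\<dots> = L * y ^ 3"
      unfolding L_def y3 exp_add[symmetric] by (simp add: algebra_simps)
    finally have 3: "exp (real N * (k * (m - \<delta>))) * ?Z (\<theta> - k) \<le> L * y ^ 3" .
    have y: "0 < y" "y < 1/2" using elim(1) by (auto simp: y_def)
    \<comment> \<open>y < 1/2 gives y - 2 y^3 \<ge> y^2, so removing the tails costs only another
      factor y.\<close>
    have "y\<^sup>2 \<le> 1/4" using power_mono[of y "1/2" 2] y by (simp add: power2_eq_square)
    then have "y * y \<le> y * (1 - 2 * y\<^sup>2)" using y by (intro mult_left_mono) auto
    then have "L * (y * y) \<le> L * (y - 2 * y ^ 3)"
      by (intro mult_left_mono) (auto simp: L_def algebra_simps power2_eq_square power3_eq_cube)
    then have "L * (y * y) \<le> exp (real N * (\<theta> * m + \<bar>\<theta>\<bar> * \<delta>)) * measure_pmf.prob (M N) ?S"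
      using Z 1 2 3 by (simp add: algebra_simps)
    then have "exp (- (real N * (\<theta> * m + \<bar>\<theta>\<bar> * \<delta>))) * (L * (y * y))
        \<le> exp (- (real N * (\<theta> * m + \<bar>\<theta>\<bar> * \<delta>))) * (exp (real N * (\<theta> * m + \<bar>\<theta>\<bar> * \<delta>)) * measure_pmf.prob (M N) ?S)"
      by (intro mult_left_mono) auto
    also have "\<dots> = measure_pmf.prob (M N) ?S" by (simp add: exp_minus)
    also have "exp (- (real N * (\<theta> * m + \<bar>\<theta>\<bar> * \<delta>))) * (L * (y * y)) = exp (real N * (\<Lambda> \<theta> - \<theta> * m - \<bar>\<theta>\<bar> * \<delta> - 2 * r))"
      by (simp add: L_def y_def algebra_simps flip: exp_add)
    finally have "exp (real N * (\<Lambda> \<theta> - \<theta> * m - \<bar>\<theta>\<bar> * \<delta> - 2 * r)) \<le> measure_pmf.prob (M N) ?S" .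
    moreover have "exp (real N * (\<Lambda> \<theta> - \<theta> * m - \<bar>\<theta>\<bar> * \<delta> - e)) \<le> exp (real N * (\<Lambda> \<theta> - \<theta> * m - \<bar>\<theta>\<bar> * \<delta> - 2 * r))"
      using r4(1) r by (intro exp_le_cancel_iff[THEN iffD2] mult_left_mono) auto
    ultimately show ?case by linarith
  qed
qed

text \<open>The entropy is the Legendre transform of the Bernoulli cumulant function. At m = 0 or 1
  the optimal \<theta> is infinite, so \<open>tilt\<close> replaces it at a loss of ln
  (1+\<epsilon>) \<le> \<epsilon>, half of the gap. The sign of \<theta> decides which tail it
  controls.\<close>

lemma entropy_dual:
  assumes \<gamma>: "0 < \<gamma>" "\<gamma> < 1" and m: "m \<in> {0..1}" and c: "c < bernoulli_entropy \<gamma> m"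
  obtains \<theta> where "c < \<theta> * m - ln (1 - \<gamma> + \<gamma> * exp \<theta>)" "m \<ge> \<gamma> \<Longrightarrow> \<theta> \<ge> 0" "m \<le> \<gamma> \<Longrightarrow> \<theta> \<le> 0"
proof -
  define \<epsilon> where "\<epsilon> = (bernoulli_entropy \<gamma> m - c) / 2"
  have \<epsilon>: "\<epsilon> > 0" using c by (simp add: \<epsilon>_def)
  define u where "u = (m + \<epsilon> * \<gamma>) / \<gamma>"
  define v where "v = (1 - m + \<epsilon> * (1 - \<gamma>)) / (1 - \<gamma>)"
  have uv: "u > 0" "v > 0"
    unfolding u_def v_def using \<gamma> m \<epsilon> by (auto intro!: divide_pos_pos add_nonneg_pos)
  have t: "tilt \<gamma> \<epsilon> m = ln u - ln v" by (simp add: tilt_def u_def v_def)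
  have "exp (tilt \<gamma> \<epsilon> m) = u / v"
    using exp_tilt(1)[OF \<gamma> \<epsilon>, of m] m by (simp add: u_def v_def)
  moreover have "(1 - \<gamma>) * v + \<gamma> * u = 1 + \<epsilon>"
  proof -
    have "(1 - \<gamma>) * v = 1 - m + \<epsilon> * (1 - \<gamma>)" "\<gamma> * u = m + \<epsilon> * \<gamma>"
      using \<gamma> by (simp_all add: u_def v_def)
    then show ?thesis by (simp add: algebra_simps)
  qed
  ultimately have "1 - \<gamma> + \<gamma> * exp (tilt \<gamma> \<epsilon> m) = (1 + \<epsilon>) / v"
    using uv by (simp add: field_simps)
  then have L: "ln (1 - \<gamma> + \<gamma> * exp (tilt \<gamma> \<epsilon> m)) = ln (1 + \<epsilon>) - ln v"
    using uv \<epsilon> by (simp add: ln_div)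
  have "bernoulli_entropy \<gamma> m \<le> m * ln u + (1 - m) * ln v"
    unfolding bernoulli_entropy_def u_def v_def
    using xlnx_perturb[of m \<gamma> \<epsilon>] xlnx_perturb[of "1 - m" "1 - \<gamma>" \<epsilon>] m \<gamma> \<epsilon> by (intro add_mono) auto
  moreover have "ln (1 + \<epsilon>) \<le> \<epsilon>" using \<epsilon> by (intro ln_add_one_self_le_self) simp
  moreover have "tilt \<gamma> \<epsilon> m * m = m * ln u + (1 - m) * ln v - ln v"
    unfolding t by (simp add: algebra_simps)
  ultimately have "bernoulli_entropy \<gamma> m - \<epsilon> \<le> tilt \<gamma> \<epsilon> m * m - ln (1 - \<gamma> + \<gamma> * exp (tilt \<gamma> \<epsilon> m))"
    unfolding L by linarith
  moreover have "c < bernoulli_entropy \<gamma> m - \<epsilon>" using c by (simp add: \<epsilon>_def field_simps)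
  ultimately have 1: "c < tilt \<gamma> \<epsilon> m * m - ln (1 - \<gamma> + \<gamma> * exp (tilt \<gamma> \<epsilon> m))" by linarith
  have u': "u = m / \<gamma> + \<epsilon>" and v': "v = (1 - m) / (1 - \<gamma>) + \<epsilon>"
    unfolding u_def v_def using \<gamma> by (simp_all add: add_divide_distrib)
  have 2: "tilt \<gamma> \<epsilon> m \<ge> 0" if "m \<ge> \<gamma>"
  proof -
    have "(1 - m) / (1 - \<gamma>) \<le> 1" "1 \<le> m / \<gamma>" using that \<gamma> by (simp_all add: divide_simps)
    then show ?thesis unfolding t using uv u' v' by simp
  qed
  have 3: "tilt \<gamma> \<epsilon> m \<le> 0" if "m \<le> \<gamma>"
  proof -
    have "1 \<le> (1 - m) / (1 - \<gamma>)" "m / \<gamma> \<le> 1" using that \<gamma> by (simp_all add: divide_simps)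
    then show ?thesis unfolding t using uv u' v' by simp
  qed
  show ?thesis using that 1 2 3 by blast
qed

section \<open>Extended logarithms and the two large deviation bounds\<close>

lemma elog_le:
  assumes "N > 0" "0 \<le> p" "p \<le> K * exp (- real N * c)" "K > 0"
  shows "ereal (1 / real N) * elog p \<le> ereal (ln K / real N - c)"
proof (cases "p = 0")
  case False
  then have "p > 0" using assms by simp
  then have "ln p \<le> ln (K * exp (- real N * c))" using assms by (intro ln_mono) auto
  also have "\<dots> = ln K - real N * c" using assms by (simp add: ln_mult)
  finally have "1 / real N * ln p \<le> 1 / real N * (ln K - real N * c)"
    by (intro mult_left_mono) auto
  then show ?thesis using assms False by (simp add: elog_def field_simps)
qed (use assms in \<open>simp add: elog_def\<close>)

lemma elog_ge:
  assumes "N > 0" "exp (real N * b) \<le> p"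
  shows "ereal b \<le> ereal (1 / real N) * elog p"
proof -
  have p: "p > 0" using assms(2) exp_gt_zero[of "real N * b"] by linarith
  have "real N * b \<le> ln p" using assms(2) p by (simp add: ln_ge_iff)
  then show ?thesis using p assms(1) by (simp add: elog_def field_simps)
qed

text \<open>Testing with real c below z also covers z = \<infinity>, the infimum over an empty
  set.\<close>

lemma ereal_le_uminusI:
  fixes x z :: ereal
  assumes "\<And>c::real. ereal c < z \<Longrightarrow> x \<le> - ereal c"
  shows "x \<le> - z"
proof (rule ccontr)
  assume "\<not> x \<le> - z"
  then have "- x < z" by (simp add: ereal_uminus_less_reorder not_le)
  then obtain y where "- x < ereal y" "ereal y < z" using ereal_dense2 by blast
  with assms[of y] show False by (metis ereal_minus_le_minus ereal_uminus_uminus not_le)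
qed

text \<open>On each side of \<gamma> the set lies beyond its point nearest to \<gamma>, which by
  compactness belongs to F and so has entropy above c. One Chernoff bound at that point covers the
  whole half.\<close>

lemma ldp_upper:
  assumes mgf: "has_log_mgf M X (\<lambda>\<theta>. ln (1 - \<gamma> + \<gamma> * exp \<theta>))" and \<gamma>: "0 < \<gamma>" "\<gamma> < 1"
    and F: "closedin (top_of_set {0..1}) F"
  shows "limsup (\<lambda>N. ereal (1 / real N) * elog (measure_pmf.prob (M N) {x. X N x \<in> F}))
    \<le> - (INF m\<in>F. ereal (bernoulli_entropy \<gamma> m))"
proof (rule ereal_le_uminusI)
  fix c :: real assume c: "ereal c < (INF m\<in>F. ereal (bernoulli_entropy \<gamma> m))"
  have cW: "c < bernoulli_entropy \<gamma> m" if "m \<in> F" for m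
    using less_INF_D[OF c that] by simp
  have F01: "F \<subseteq> {0..1}" using F closedin_subset by fastforce
  have comp: "compact F" using F closedin_compact by blast
  have right: "\<forall>\<^sub>F N in sequentially. measure_pmf.prob (M N) {x. X N x \<in> F \<inter> {\<gamma>..}} \<le> exp (- real N * c)"
  proof (cases "F \<inter> {\<gamma>..} = {}")
    case False
    then obtain m where m: "m \<in> F \<inter> {\<gamma>..}" "\<And>y. y \<in> F \<inter> {\<gamma>..} \<Longrightarrow> m \<le> y"
      using compact_attains_inf[of "F \<inter> {\<gamma>..}"] compact_Int_closed[OF comp closed_atLeast] by blast
    have m01: "m \<in> {0..1}" using m F01 by blast
    obtain \<theta> where \<theta>: "c < \<theta> * m - ln (1 - \<gamma> + \<gamma> * exp \<theta>)" "m \<ge> \<gamma> \<Longrightarrow> \<theta> \<ge> 0"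
      using entropy_dual[OF \<gamma> m01 cW] m(1) by blast
    have "\<theta> \<ge> 0" using \<theta>(2) m(1) by simp
    from chernoff_upper[OF mgf \<theta>(1)] show ?thesis
    proof eventually_elim
      case (elim N)
      have "measure_pmf.prob (M N) {x. X N x \<in> F \<inter> {\<gamma>..}} \<le> measure_pmf.prob (M N) {x. \<theta> * m \<le> \<theta> * X N x}"
        using m(2) \<open>\<theta> \<ge> 0\<close> by (intro measure_pmf.finite_measure_mono) (auto intro!: mult_left_mono)
      with elim show ?case by linarith
    qed
  qed simp
  have left: "\<forall>\<^sub>F N in sequentially. measure_pmf.prob (M N) {x. X N x \<in> F \<inter> {..\<gamma>}} \<le> exp (- real N * c)"
  proof (cases "F \<inter> {..\<gamma>} = {}")
    case False
    then obtain m where m: "m \<in> F \<inter> {..\<gamma>}" "\<And>y. y \<in> F \<inter> {..\<gamma>} \<Longrightarrow> y \<le> m"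
      using compact_attains_sup[of "F \<inter> {..\<gamma>}"] compact_Int_closed[OF comp closed_atMost] by blast
    have m01: "m \<in> {0..1}" using m F01 by blast
    obtain \<theta> where \<theta>: "c < \<theta> * m - ln (1 - \<gamma> + \<gamma> * exp \<theta>)" "m \<le> \<gamma> \<Longrightarrow> \<theta> \<le> 0"
      using entropy_dual[OF \<gamma> m01 cW] m(1) by blast
    have "\<theta> \<le> 0" using \<theta>(2) m(1) by simp
    from chernoff_upper[OF mgf \<theta>(1)] show ?thesis
    proof eventually_elim
      case (elim N)
      have "measure_pmf.prob (M N) {x. X N x \<in> F \<inter> {..\<gamma>}} \<le> measure_pmf.prob (M N) {x. \<theta> * m \<le> \<theta> * X N x}"
        using m(2) \<open>\<theta> \<le> 0\<close> by (intro measure_pmf.finite_measure_mono) (auto intro!: mult_left_mono_neg)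
      with elim show ?case by linarith
    qed
  qed simp
  have "\<forall>\<^sub>F N in sequentially. ereal (1 / real N) * elog (measure_pmf.prob (M N) {x. X N x \<in> F}) \<le> ereal (ln 2 / real N - c)"
    using left right eventually_gt_at_top[of 0]
  proof eventually_elim
    case (elim N)
    have "{x. X N x \<in> F} = {x. X N x \<in> F \<inter> {..\<gamma>}} \<union> {x. X N x \<in> F \<inter> {\<gamma>..}}" by auto
    then have "measure_pmf.prob (M N) {x. X N x \<in> F}
        \<le> measure_pmf.prob (M N) {x. X N x \<in> F \<inter> {..\<gamma>}} + measure_pmf.prob (M N) {x. X N x \<in> F \<inter> {\<gamma>..}}"
      by (simp only:) (intro measure_Un_le; simp)
    then have "measure_pmf.prob (M N) {x. X N x \<in> F} \<le> 2 * exp (- real N * c)"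
      using elim(1,2) by linarith
    then show ?case using elim(3) by (intro elog_le) auto
  qed
  then have "limsup (\<lambda>N. ereal (1 / real N) * elog (measure_pmf.prob (M N) {x. X N x \<in> F}))
      \<le> limsup (\<lambda>N. ereal (ln 2 / real N - c))"
    by (rule Limsup_mono)
  also have "\<dots> = ereal (- c)"
  proof (intro lim_imp_Limsup)
    have "(\<lambda>N. ln 2 / real N - c) \<longlonglongrightarrow> - c" by real_asymp
    then show "(\<lambda>N. ereal (ln 2 / real N - c)) \<longlonglongrightarrow> ereal (- c)" by simp
  qed simp
  finally show "limsup (\<lambda>N. ereal (1 / real N) * elog (measure_pmf.prob (M N) {x. X N x \<in> F})) \<le> - ereal c"
    by simp
qed

text \<open>Inside (0,1) the derivative of the entropy is finite and is the exact tilt: the cumulant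
  function has slope m there, and its Legendre value is the entropy.\<close>

lemma ldp_lower_interior:
  assumes mgf: "has_log_mgf M X (\<lambda>\<theta>. ln (1 - \<gamma> + \<gamma> * exp \<theta>))" and \<gamma>: "0 < \<gamma>" "\<gamma> < 1"
    and X: "\<forall>\<^sub>F N in sequentially. \<forall>x\<in>set_pmf (M N). X N x \<in> {0..1}"
    and U: "openin (top_of_set {0..1}) U" and m: "m \<in> U" "0 < m" "m < 1"
  shows "ereal (- bernoulli_entropy \<gamma> m)
    \<le> liminf (\<lambda>N. ereal (1 / real N) * elog (measure_pmf.prob (M N) {x. X N x \<in> U}))"
proof (rule ereal_le_epsilon2)
  fix e :: real assume e: "e > 0"
  define \<theta> where "\<theta> = ln (m / \<gamma>) - ln ((1 - m) / (1 - \<gamma>))"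
  have ex: "exp \<theta> = (m / \<gamma>) / ((1 - m) / (1 - \<gamma>))"
    unfolding \<theta>_def using m \<gamma> by (simp add: exp_diff)
  have M: "1 - \<gamma> + \<gamma> * exp \<theta> = (1 - \<gamma>) / (1 - m)"
    unfolding ex using m \<gamma> by (simp add: field_simps)
  have pos: "1 - \<gamma> + \<gamma> * exp \<theta> > 0" using \<gamma> by (intro add_pos_pos) auto
  have g: "\<gamma> * exp \<theta> / (1 - \<gamma> + \<gamma> * exp \<theta>) = m"
  proof -
    have "\<gamma> * exp \<theta> = m * ((1 - \<gamma>) / (1 - m))" unfolding ex using m \<gamma> by simp
    then show ?thesis unfolding M using m \<gamma> by simp
  qed
  have D: "((\<lambda>\<theta>. ln (1 - \<gamma> + \<gamma> * exp \<theta>)) has_real_derivative m) (at \<theta>)"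
    using pos g by (auto intro!: derivative_eq_intros)
  have rate: "ln (1 - \<gamma> + \<gamma> * exp \<theta>) - \<theta> * m = - bernoulli_entropy \<gamma> m"
  proof -
    have "ln (1 - \<gamma> + \<gamma> * exp \<theta>) = - ln ((1 - m) / (1 - \<gamma>))"
      unfolding M using m \<gamma> by (simp add: ln_div)
    then show ?thesis by (simp add: bernoulli_entropy_def \<theta>_def algebra_simps)
  qed
  obtain \<delta>0 where \<delta>0: "\<delta>0 > 0" "\<And>y. y \<in> {0..1} \<Longrightarrow> \<bar>y - m\<bar> < \<delta>0 \<Longrightarrow> y \<in> U"
    using U m(1) unfolding openin_euclidean_subtopology_iff by (auto simp: dist_real_def)
  \<comment> \<open>Small enough to stay in U and to make |\<theta>|\<delta> at most e/2; the + 1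
    covers \<theta> = 0.\<close>
  define \<delta> where "\<delta> = min \<delta>0 (e / (2 * (\<bar>\<theta>\<bar> + 1)))"
  have \<delta>: "\<delta> > 0" using \<delta>0 e by (simp add: \<delta>_def add_nonneg_pos)
  have "\<bar>\<theta>\<bar> * \<delta> \<le> (\<bar>\<theta>\<bar> + 1) * (e / (2 * (\<bar>\<theta>\<bar> + 1)))"
    using \<delta> by (intro mult_mono) (auto simp: \<delta>_def)
  also have "\<dots> = e / 2" using abs_ge_zero[of \<theta>] by (simp add: field_simps add_nonneg_eq_0_iff)
  finally have \<theta>\<delta>: "\<bar>\<theta>\<bar> * \<delta> \<le> e / 2" .
  have "\<forall>\<^sub>F N in sequentially. ereal (- bernoulli_entropy \<gamma> m - e)
      \<le> ereal (1 / real N) * elog (measure_pmf.prob (M N) {x. X N x \<in> U})"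
    using tilting_lower[OF mgf D \<delta> half_gt_zero[OF e]] X eventually_gt_at_top[of 0]
  proof eventually_elim
    case (elim N)
    have "exp (real N * (- bernoulli_entropy \<gamma> m - e)) \<le> exp (real N * (ln (1 - \<gamma> + \<gamma> * exp \<theta>) - \<theta> * m - \<bar>\<theta>\<bar> * \<delta> - e / 2))"
      unfolding rate using \<theta>\<delta> by (intro exp_le_cancel_iff[THEN iffD2] mult_left_mono) auto
    also have "\<dots> \<le> measure_pmf.prob (M N) {x. \<bar>X N x - m\<bar> < \<delta>}" by (rule elim(1))
    \<comment> \<open>U is open only relative to [0,1], so the inclusion holds on the support of
      \<open>M N\<close>.\<close>
    also have "\<dots> \<le> measure_pmf.prob (M N) {x. X N x \<in> U}"
      using elim(2) \<delta>0(2)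
      by (intro measure_pmf.finite_measure_mono_AE) (auto simp: AE_measure_pmf_iff \<delta>_def)
    finally show ?case using elim(3) by (intro elog_ge)
  qed
  then have "ereal (- bernoulli_entropy \<gamma> m - e)
      \<le> liminf (\<lambda>N. ereal (1 / real N) * elog (measure_pmf.prob (M N) {x. X N x \<in> U}))"
    by (rule Liminf_bounded)
  then have "ereal (- bernoulli_entropy \<gamma> m - e) + ereal e
      \<le> liminf (\<lambda>N. ereal (1 / real N) * elog (measure_pmf.prob (M N) {x. X N x \<in> U})) + ereal e"
    by (rule add_right_mono)
  then show "ereal (- bernoulli_entropy \<gamma> m)
      \<le> liminf (\<lambda>N. ereal (1 / real N) * elog (measure_pmf.prob (M N) {x. X N x \<in> U})) + ereal e"
    by simp
qed

text \<open>The end points have no finite tilt. They are approached along the segment towards 1/2,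
  using continuity of the entropy.\<close>

lemma ldp_lower:
  assumes mgf: "has_log_mgf M X (\<lambda>\<theta>. ln (1 - \<gamma> + \<gamma> * exp \<theta>))" and \<gamma>: "0 < \<gamma>" "\<gamma> < 1"
    and X: "\<forall>\<^sub>F N in sequentially. \<forall>x\<in>set_pmf (M N). X N x \<in> {0..1}"
    and U: "openin (top_of_set {0..1}) U" and m: "m \<in> U"
  shows "ereal (- bernoulli_entropy \<gamma> m)
    \<le> liminf (\<lambda>N. ereal (1 / real N) * elog (measure_pmf.prob (M N) {x. X N x \<in> U}))"
    (is "_ \<le> ?L")
proof -
  have m01: "m \<in> {0..1}" using U m openin_imp_subset by blast
  obtain V where V: "open V" "U = {0..1} \<inter> V" using U by (auto simp: openin_open)
  define p where "p t = m + t * (1 / 2 - m)" for t :: real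
  have p: "p t \<in> {0<..<1}" if "0 < t" "t < 1" for t
  proof -
    have "0 \<le> (1 - t) * m" "(1 - t) * m \<le> 1 - t"
      using m01 that by (auto intro!: mult_left_le)
    then show ?thesis using that by (simp add: p_def algebra_simps)
  qed
  have lim: "(p \<longlongrightarrow> m) (at_right 0)"
  proof -
    have "(p \<longlongrightarrow> p 0) (at_right 0)" unfolding p_def by (intro tendsto_intros)
    then show ?thesis by (simp add: p_def)
  qed
  have ev01: "\<forall>\<^sub>F t in at_right 0. p t \<in> {0<..<1}"
    using eventually_at_right_real[OF zero_less_one] by eventually_elim (use p in auto)
  have evV: "\<forall>\<^sub>F t in at_right 0. p t \<in> V"
    using lim V m topological_tendstoD by blast
  have "((\<lambda>t. bernoulli_entropy \<gamma> (p t)) \<longlongrightarrow> bernoulli_entropy \<gamma> m) (at_right 0)"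
  proof (rule continuous_on_tendsto_compose[OF continuous_on_bernoulli_entropy[OF \<gamma>] lim m01])
    show "\<forall>\<^sub>F t in at_right 0. p t \<in> {0..1}" using ev01 by eventually_elim auto
  qed
  then have "((\<lambda>t. ereal (- bernoulli_entropy \<gamma> (p t))) \<longlongrightarrow> ereal (- bernoulli_entropy \<gamma> m)) (at_right 0)"
    by (intro tendsto_intros)
  then show ?thesis
  proof (rule tendsto_upperbound)
    show "\<forall>\<^sub>F t in at_right 0. ereal (- bernoulli_entropy \<gamma> (p t)) \<le> ?L"
      using ev01 evV
    proof eventually_elim
      case (elim t)
      then show ?case
        by (intro ldp_lower_interior[OF mgf \<gamma> X U]) (auto simp: V(2))
    qed
  qed simp
qed

lemma total_mass_log_mgf:
  assumes ab: "0 < \<alpha>" "\<alpha> < 1" "0 < \<beta>" "\<beta> < 1" and \<gamma>: "\<gamma> = (\<alpha> + \<beta>) / 2"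
    and st: "\<And>N. N \<ge> 3 \<Longrightarrow> stationary \<alpha> \<beta> N (\<mu> N)"
  shows "has_log_mgf \<mu> total_mass (\<lambda>\<theta>. ln (1 - \<gamma> + \<gamma> * exp \<theta>))"
  unfolding has_log_mgf_def
proof (intro conjI allI impI)
  show "\<forall>\<^sub>F N in sequentially. finite (set_pmf (\<mu> N))"
    using eventually_ge_at_top[of 3]
    by eventually_elim (use st in \<open>auto simp: stationary_def intro: finite_subset[OF _ finite_configs]\<close>)
next
  fix \<theta> e :: real assume e: "e > 0"
  define M where "M = 1 - \<gamma> + \<gamma> * exp \<theta>"
  have M: "M > 0" using ab unfolding M_def \<gamma> by (intro add_pos_pos) auto
  \<comment> \<open>Neither the N - 1 sites against the normalisation 1/N nor the correction factor
    changes the exponential rate.\<close>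
  have "(\<lambda>N. (real N - 1) / real N * ln (M * (1 - 1 / real N))) \<longlonglongrightarrow> ln M"
    using M by real_asymp
  then have l: "\<forall>\<^sub>F N in sequentially. ln M - e < (real N - 1) / real N * ln (M * (1 - 1 / real N))"
    by (rule order_tendstoD) (use e in simp)
  have "(\<lambda>N. (real N - 1) / real N * ln (M * (1 + 1 / real N))) \<longlonglongrightarrow> ln M"
    using M by real_asymp
  then have u: "\<forall>\<^sub>F N in sequentially. (real N - 1) / real N * ln (M * (1 + 1 / real N)) < ln M + e"
    by (rule order_tendstoD) (use e in simp)
  from l u eventually_ge_at_top[of 3]
  show "\<forall>\<^sub>F N in sequentially.
      exp (real N * (ln (1 - \<gamma> + \<gamma> * exp \<theta>) - e)) \<le> measure_pmf.expectation (\<mu> N) (\<lambda>\<eta>. exp (real N * (\<theta> * total_mass N \<eta>))) \<and>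
      measure_pmf.expectation (\<mu> N) (\<lambda>\<eta>. exp (real N * (\<theta> * total_mass N \<eta>))) \<le> exp (real N * (ln (1 - \<gamma> + \<gamma> * exp \<theta>) + e))"
  proof eventually_elim
    case (elim N)
    have N: "real N > 0" "real (N - 1) = real N - 1" using elim(3) by auto
    have tm: "real N * (\<theta> * total_mass N \<eta>) = \<theta> * (\<Sum>x=1..N-1. real (\<eta> x))" for \<eta>
      using N by (simp add: total_mass_def)
    have pw: "(M * y) ^ (N - 1) = exp (real N * ((real N - 1) / real N * ln (M * y)))" if "y > 0" for y
    proof -
      have "(M * y) ^ (N - 1) = exp (real (N - 1) * ln (M * y))"
        using M that by (simp add: exp_of_nat_mult)
      then show ?thesis using N by simp
    qed
    note b = mgf_bounds[OF st[OF elim(3)] elim(3) ab, of \<theta>, folded \<gamma>, folded M_def]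
    have "1 - 1 / real N > 0" "1 + 1 / real N > 0" using elim(3) by (simp_all add: add_pos_pos)
    note pw = pw[OF this(1)] pw[OF this(2)]
    have "exp (real N * (ln M - e)) \<le> (M * (1 - 1 / real N)) ^ (N - 1)"
      unfolding pw(1) by (intro exp_le_cancel_iff[THEN iffD2] mult_left_mono less_imp_le[OF elim(1)]) simp
    moreover have "(M * (1 + 1 / real N)) ^ (N - 1) \<le> exp (real N * (ln M + e))"
      unfolding pw(2) by (intro exp_le_cancel_iff[THEN iffD2] mult_left_mono less_imp_le[OF elim(2)]) simp
    ultimately show ?case unfolding tm M_def[symmetric] using b by linarith
  qed
qed

lemma total_mass_bounds:
  assumes "N \<ge> 3" "\<eta> \<in> configs N"
  shows "total_mass N \<eta> \<in> {0..1}"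
proof -
  have "(\<Sum>x = 1..N-1. real (\<eta> x)) \<le> (\<Sum>x = 1..N-1. 1)"
    using configsD[OF assms(2)] by (intro sum_mono) force
  also have "\<dots> \<le> real N" using assms(1) by simp
  finally show ?thesis
    using assms(1) by (auto simp: total_mass_def sum_nonneg divide_simps)
qed

theorem theorem2p9:
  fixes \<alpha> \<beta> \<gamma> :: real and \<mu> :: "nat \<Rightarrow> (nat \<Rightarrow> nat) pmf"
  assumes "0 < \<alpha>" "\<alpha> < 1" "0 < \<beta>" "\<beta> < 1"
    and "\<gamma> = (\<alpha> + \<beta>) / 2"
    and "\<And>N. N \<ge> 3 \<Longrightarrow> stationary \<alpha> \<beta> N (\<mu> N)"
  shows "(\<forall>F. closedin (top_of_set {0..1}) F \<longrightarrow>
            limsup (\<lambda>N. ereal (1 / real N) *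
                elog (measure_pmf.prob (\<mu> N) {\<eta>. total_mass N \<eta> \<in> F}))
              \<le> - (INF m\<in>F. quasi_potential \<gamma> m)) \<and>
         (\<forall>U. openin (top_of_set {0..1}) U \<longrightarrow>
            liminf (\<lambda>N. ereal (1 / real N) *
                elog (measure_pmf.prob (\<mu> N) {\<eta>. total_mass N \<eta> \<in> U}))
              \<ge> - (INF m\<in>U. quasi_potential \<gamma> m))"
proof (intro conjI allI impI)
  have \<gamma>: "0 < \<gamma>" "\<gamma> < 1" using assms by auto
  note mgf = total_mass_log_mgf[OF assms]
  {
    fix F :: "real set" assume F: "closedin (top_of_set {0..1}) F"
    have "quasi_potential \<gamma> m = ereal (bernoulli_entropy \<gamma> m)" if "m \<in> F" for m
      using that F closedin_subset by (intro quasi_potential_eq_entropy \<gamma>) fastforce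
    then have "(INF m\<in>F. quasi_potential \<gamma> m) = (INF m\<in>F. ereal (bernoulli_entropy \<gamma> m))"
      by (intro INF_cong) auto
    then show "limsup (\<lambda>N. ereal (1 / real N) *
        elog (measure_pmf.prob (\<mu> N) {\<eta>. total_mass N \<eta> \<in> F})) \<le> - (INF m\<in>F. quasi_potential \<gamma> m)"
      using ldp_upper[OF mgf \<gamma> F] by simp
  }
  fix U :: "real set" assume U: "openin (top_of_set {0..1}) U"
  let ?L = "liminf (\<lambda>N. ereal (1 / real N) * elog (measure_pmf.prob (\<mu> N) {\<eta>. total_mass N \<eta> \<in> U}))"
  have X: "\<forall>\<^sub>F N in sequentially. \<forall>\<eta>\<in>set_pmf (\<mu> N). total_mass N \<eta> \<in> {0..1}"
    using eventually_ge_at_top[of 3]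
  proof eventually_elim
    case (elim N)
    then have "set_pmf (\<mu> N) \<subseteq> configs N" using assms(6) by (simp add: stationary_def)
    then show ?case using total_mass_bounds[OF elim] by blast
  qed
  \<comment> \<open>Here the inequality V \<ge> W suffices; near-optimal paths enter the upper large
    deviation bound.\<close>
  have "- ?L \<le> (INF m\<in>U. quasi_potential \<gamma> m)"
  proof (rule INF_greatest)
    fix m assume m: "m \<in> U"
    have "- ?L \<le> - ereal (- bernoulli_entropy \<gamma> m)"
      using ldp_lower[OF mgf \<gamma> X U m] by (simp only: ereal_minus_le_minus)
    also have "\<dots> = ereal (bernoulli_entropy \<gamma> m)" by simp
    also have "\<dots> \<le> quasi_potential \<gamma> m" by (rule entropy_le_quasi_potential[OF \<gamma>])
    finally show "- ?L \<le> quasi_potential \<gamma> m" .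
  qed
  then show "- (INF m\<in>U. quasi_potential \<gamma> m) \<le> ?L"
    by (simp add: ereal_uminus_le_reorder)
qed

end
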